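(* Let $G$ be a graph of order $|G|\geqslant 6$ with maximum degree $\Delta=\Delta(G)$. If $(|G|+1)/3 \leqslant \Delta < |G|/2$ and no component of $G$ is a complete graph $K_{\Delta+1}$, then $G$ is equitably $\Delta$-colorable.
   Context: All graphs are finite, without loops and without multiple edges; they are not assumed to be connected. $|G|$ denotes the number of vertices of $G$, and $\Delta(G)$ the maximum degree of a vertex of $G$. A component is a maximal connected subgraph. A $k$-coloring of $G$ is a map $\pi:V(G)\to\{1,\dots,k\}$ assigning distinct values to adjacent vertices; its color classes are the preimages $V_i=\pi^{-1}(i)$, $1\leqslant i\leqslant k$. $G$ is equitably $k$-colorable if it has a $k$-coloring with $\bigl||V_i|-|V_j|\bigr|\leqslant 1$ for every pair of color classes $V_i,V_j$. *)

theory Defs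
  imports Complex_Main "Graph_Theory.Graph_Theory"
begin

text \<open>
  Simple undirected graphs are rendered by the locale \<^locale>\<open>graph\<close>: finite symmetric digraphs
  without loops and without parallel arcs.  An undirected edge is a pair of opposite arcs, so
  the degree of a vertex is its out-degree (see \<open>out_degree_eq_card_neighbours\<close>).
\<close>

definition max_degree :: "('a, 'b) pre_digraph \<Rightarrow> nat" where
  "max_degree G = Max (out_degree G ` verts G)"

lemma (in graph) out_degree_eq_card_neighbours:
  "out_degree G v = card {w. v \<rightarrow>\<^bsub>G\<^esub> w}"
proof -
  have "inj_on (head G) (out_arcs G v)"
    using no_multi_arcs by (auto simp: inj_on_def out_arcs_def arc_to_ends_def)
  moreover have "head G ` out_arcs G v = {w. v \<rightarrow>\<^bsub>G\<^esub> w}"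
    by (auto simp: out_arcs_def arcs_ends_conv)
  ultimately show ?thesis
    unfolding out_degree_def by (metis card_image)
qed

definition is_component :: "('a, 'b) pre_digraph \<Rightarrow> ('a, 'b) pre_digraph \<Rightarrow> bool" where
  "is_component H G \<longleftrightarrow> pre_digraph.max_subgraph G connected H"

definition color_class :: "('a, 'b) pre_digraph \<Rightarrow> ('a \<Rightarrow> nat) \<Rightarrow> nat \<Rightarrow> 'a set" where
  "color_class G \<pi> i = {v \<in> verts G. \<pi> v = i}"

text \<open>The values of \<open>\<pi>\<close> outside \<open>verts G\<close> are irrelevant.\<close>

definition is_coloring :: "('a, 'b) pre_digraph \<Rightarrow> nat \<Rightarrow> ('a \<Rightarrow> nat) \<Rightarrow> bool" where
  "is_coloring G k \<pi> \<longleftrightarrow>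
     \<pi> \<in> verts G \<rightarrow> {1..k} \<and> (\<forall>u v. u \<rightarrow>\<^bsub>G\<^esub> v \<longrightarrow> \<pi> u \<noteq> \<pi> v)"

definition equitably_colorable :: "('a, 'b) pre_digraph \<Rightarrow> nat \<Rightarrow> bool" where
  "equitably_colorable G k \<longleftrightarrow>
     (\<exists>\<pi>. is_coloring G k \<pi> \<and>
       (\<forall>i\<in>{1..k}. \<forall>j\<in>{1..k}.
          \<bar>int (card (color_class G \<pi> i)) - int (card (color_class G \<pi> j))\<bar> \<le> 1))"

end

theory Submission
  imports Defs "HOL-Library.Multiset"
begin

text \<open>
  Write \<open>k = \<Delta>\<close> and \<open>|G| = 2a + 3b\<close> with \<open>a + b = k\<close>; the hypotheses give \<open>a, b \<ge> 1\<close>.  In the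
  complement \<open>H\<close> of \<open>G\<close>, an equitable \<open>k\<close>-coloring is a partition of the vertices into \<open>a\<close> edges and \<open>b\<close>
  triangles (the tiles), while \<open>H\<close> has minimum degree at least \<open>a + 2b - 1\<close> and, since \<open>G\<close> has no complete
  component on \<open>k + 1\<close> vertices, no independent set of size \<open>k + 1\<close>.  Both properties survive adding an edge \<open>xy\<close> to
  \<open>H\<close>, so by induction we may assume that \<open>H + xy\<close> has a tiling.  If it uses \<open>xy\<close>, then \<open>H\<close> has
  a partial tiling that either misses two vertices (\<open>a - 1\<close> edges and \<open>b\<close> triangles) or misses one vertex
  (\<open>a + 1\<close> edges and \<open>b - 1\<close> triangles).

  If two vertices \<open>x, y\<close> are missed and \<open>H\<close> has no tiling, then the degree condition is tight: in each tile, \<open>x\<close>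
  and \<open>y\<close> have the same unique nonneighbour.  Exchanging \<open>x\<close> with such a nonneighbour gives a configuration
  of the same kind, so the nonneighbours of \<open>y\<close> form an independent set of size \<open>k + 1\<close>.

  If one vertex \<open>x\<close> is missed, every local exchange that would miss two vertices is now forbidden.  Counting the
  edges between the edge tiles and the triangle tiles then shows that \<open>x\<close> has exactly one nonneighbour in each tile,
  unless \<open>x\<close> is adjacent to a whole triangle; the latter is excluded by comparing several
  choices of the missed vertex.  Finally, as in the proof of Brooks' theorem, exchanges of
  the missed vertex show that the nonneighbours of \<open>x\<close> are independent, again giving an independent set of size \<open>k + 1\<close>.
\<close>

section \<open>Partitions into edges and triangles\<close>

text \<open>Multisets make the disjointness of tiles implicit: a tiling of \<open>mset_set V\<close>
  uses each vertex of \<open>V\<close> once, and an exchange of tiles becomes an equation between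
  multisets.\<close>

inductive tiling :: "('a \<Rightarrow> 'a \<Rightarrow> bool) \<Rightarrow> 'a multiset \<Rightarrow> nat \<Rightarrow> nat \<Rightarrow> bool" for adj where
  empty: "tiling adj {#} 0 0"
| edge: "tiling adj M a b \<Longrightarrow> adj u v \<Longrightarrow> tiling adj ({#u, v#} + M) (Suc a) b"
| triangle: "tiling adj M a b \<Longrightarrow> adj u v \<Longrightarrow> adj u w \<Longrightarrow> adj v w \<Longrightarrow>
    tiling adj ({#u, v, w#} + M) a (Suc b)"

lemma tiling_add:
  assumes "tiling adj M a b" "tiling adj M' a' b'"
  shows "tiling adj (M + M') (a + a') (b + b')"
  using assms(1)
proof induction
  case empty
  then show ?case using assms(2) by simp
next
  case (edge M a b u v)
  then show ?case using tiling.edge[of adj "M + M'" "a + a'" "b + b'" u v] by simp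
next
  case (triangle M a b u v w)
  then show ?case using tiling.triangle[of adj "M + M'" "a + a'" "b + b'" u v w] by simp
qed

lemma tiling_split:
  assumes "tiling adj M a b"
  obtains A B where "M = A + B" "tiling adj A a 0" "tiling adj B 0 b"
proof -
  from assms have "\<exists>A B. M = A + B \<and> tiling adj A a 0 \<and> tiling adj B 0 b"
  proof induction
    case empty
    then show ?case using tiling.empty by fastforce
  next
    case (edge M a b u v)
    then obtain A B where "M = A + B" "tiling adj A a 0" "tiling adj B 0 b" by blast
    then show ?case using tiling.edge[of adj A a 0 u v] edge.hyps
      by (intro exI[of _ "{#u, v#} + A"] exI[of _ B]) simp
  next
    case (triangle M a b u v w)
    then obtain A B where "M = A + B" "tiling adj A a 0" "tiling adj B 0 b" by blast
    then show ?case using tiling.triangle[of adj B 0 b u v w] triangle.hyps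
      by (intro exI[of _ A] exI[of _ "{#u, v, w#} + B"]) simp
  qed
  then show thesis using that by blast
qed

lemma tiling_obtain_edge:
  assumes "tiling adj M (Suc a) b"
  obtains u v M' where "M = {#u, v#} + M'" "adj u v" "tiling adj M' a b"
proof -
  have "\<exists>u v M'. M = {#u, v#} + M' \<and> adj u v \<and> tiling adj M' a b"
    if "tiling adj M c b" "c = Suc a" for c
    using that
  proof (induction arbitrary: a)
    case empty
    then show ?case by simp
  next
    case (edge M a b u v)
    then show ?case by blast
  next
    case (triangle M c b u v w)
    then obtain u' v' M' where "M = {#u', v'#} + M'" "adj u' v'" "tiling adj M' a b" by blast
    then show ?case using tiling.triangle[of adj M' a b u v w] triangle.hyps
      by (intro exI[of _ u'] exI[of _ v'] exI[of _ "{#u, v, w#} + M'"])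
        (simp add: add_mset_commute)
  qed
  then show thesis using that assms by blast
qed

lemma tiling_obtain_triangle:
  assumes "tiling adj M a (Suc b)"
  obtains u v w M' where "M = {#u, v, w#} + M'" "adj u v" "adj u w" "adj v w" "tiling adj M' a b"
proof -
  have "\<exists>u v w M'. M = {#u, v, w#} + M' \<and> adj u v \<and> adj u w \<and> adj v w \<and> tiling adj M' a b"
    if "tiling adj M a c" "c = Suc b" for c
    using that
  proof (induction arbitrary: b)
    case empty
    then show ?case by simp
  next
    case (edge M a c u v)
    then obtain u' v' w' M' where "M = {#u', v', w'#} + M'" "adj u' v'" "adj u' w'" "adj v' w'"
      "tiling adj M' a b" by blast
    then show ?case using tiling.edge[of adj M' a b u v] edge.hyps
      by (intro exI[of _ u'] exI[of _ v'] exI[of _ w'] exI[of _ "{#u, v#} + M'"])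
        (simp add: add_mset_commute)
  next
    case (triangle M a b u v w)
    then show ?case by blast
  qed
  then show thesis using that assms by blast
qed

lemma tiling_mem:
  assumes "symp adj" and "tiling adj M a b" "x \<in># M"
  obtains (edge) y M' a' where "M = {#x, y#} + M'" "adj x y" "a = Suc a'" "tiling adj M' a' b"
  | (triangle) y z M' b' where "M = {#x, y, z#} + M'" "adj x y" "adj x z" "adj y z"
      "b = Suc b'" "tiling adj M' a b'"
proof -
  note s = sympD[OF assms(1)]
  from assms(2,3) have "(\<exists>y M' a'. M = {#x, y#} + M' \<and> adj x y \<and> a = Suc a' \<and> tiling adj M' a' b) \<or>
   (\<exists>y z M' b'. M = {#x, y, z#} + M' \<and> adj x y \<and> adj x z \<and> adj y z \<and> b = Suc b' \<and> tiling adj M' a b')"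
  proof induction
    case empty
    then show ?case by simp
  next
    case (edge M a b u v)
    consider "x = u" | "x = v" | "x \<in># M" using edge.prems by auto
    then show ?case
    proof cases
      case 1 then show ?thesis using edge.hyps by blast
    next
      case 2
      have "{#u, v#} + M = {#x, u#} + M" using 2 by (simp add: add_mset_commute)
      then show ?thesis using edge.hyps s 2 by blast
    next
      case 3
      from edge.IH[OF 3] show ?thesis
      proof (elim disjE exE conjE)
        fix y M' a' assume "M = {#x, y#} + M'" "adj x y" "a = Suc a'" "tiling adj M' a' b"
        moreover from this have "tiling adj ({#u, v#} + M') a b" using tiling.edge edge.hyps by simp
        ultimately show ?thesis by (intro disjI1 exI[of _ y] exI[of _ "{#u, v#} + M'"])
         (simp add: add_mset_commute)
      next
        fix y z M' b' assume *: "M = {#x, y, z#} + M'" "adj x y" "adj x z" "adj y z" "b = Suc b'" "tiling adj M' a b'"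
        moreover from this have "tiling adj ({#u, v#} + M') (Suc a) b'" using tiling.edge edge.hyps by simp
        ultimately show ?thesis by (intro disjI2 exI[of _ y] exI[of _ z] exI[of _ "{#u, v#} + M'"])
         (simp add: add_mset_commute)
      qed
    qed
  next
    case (triangle M a b u v w)
    consider "x = u" | "x = v" | "x = w" | "x \<in># M" using triangle.prems by auto
    then show ?case
    proof cases
      case 1 then show ?thesis using triangle.hyps by blast
    next
      case 2
      have "{#u, v, w#} + M = {#x, u, w#} + M" using 2 by (simp add: add_mset_commute)
      then show ?thesis using triangle.hyps s 2 by blast
    next
      case 3
      have "{#u, v, w#} + M = {#x, u, v#} + M" using 3 by (simp add: add_mset_commute)
      then show ?thesis using triangle.hyps s 3 by blast
    next
      case 4
      from triangle.IH[OF 4] show ?thesis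
      proof (elim disjE exE conjE)
        fix y M' a' assume "M = {#x, y#} + M'" "adj x y" "a = Suc a'" "tiling adj M' a' b"
        moreover from this have "tiling adj ({#u, v, w#} + M') a' (Suc b)" using tiling.triangle triangle.hyps by simp
        ultimately show ?thesis by (intro disjI1 exI[of _ y] exI[of _ "{#u, v, w#} + M'"])
         (simp add: add_mset_commute)
      next
        fix y z M' b' assume *: "M = {#x, y, z#} + M'" "adj x y" "adj x z" "adj y z" "b = Suc b'" "tiling adj M' a b'"
        moreover from this have "tiling adj ({#u, v, w#} + M') a b" using tiling.triangle triangle.hyps by simp
        ultimately show ?thesis by (intro disjI2 exI[of _ y] exI[of _ z] exI[of _ "{#u, v, w#} + M'"])
         (simp add: add_mset_commute)
      qed
    qed
  qed
  then show thesis using edge triangle by blast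
qed

text \<open>Each hypothesis also supplies the tiling \<open>R\<close> of the rest, because the bound
  for a tile will come from an exchange that keeps all other tiles.\<close>

lemma tiling_sum_le:
  fixes f :: "'a \<Rightarrow> nat"
  assumes "tiling adj M a b"
    and "\<And>u v R a'. M = {#u, v#} + R \<Longrightarrow> adj u v \<Longrightarrow> a = Suc a' \<Longrightarrow> tiling adj R a' b \<Longrightarrow> f u + f v \<le> c"
    and "\<And>u v w R b'. M = {#u, v, w#} + R \<Longrightarrow> adj u v \<Longrightarrow> adj u w \<Longrightarrow> adj v w \<Longrightarrow> b = Suc b' \<Longrightarrow>
        tiling adj R a b' \<Longrightarrow> f u + f v + f w \<le> d"
  shows "(\<Sum>x\<in>#M. f x) \<le> a * c + b * d"
  using assms
proof induction
  case empty
  then show ?case by simp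
next
  case (edge M a b u v)
  have "f u + f v \<le> c" using edge.prems(1)[OF refl edge.hyps(2) refl edge.hyps(1)] .
  moreover have "(\<Sum>x\<in>#M. f x) \<le> a * c + b * d"
  proof (rule edge.IH)
    \<comment> \<open>The complement \<open>R\<close> inside the smaller multiset grows by the tile
      \<open>{#u, v#}\<close>, since the premises speak of complements in the full multiset.\<close>
    fix u' v' R a' assume "M = {#u', v'#} + R" "adj u' v'" "a = Suc a'" "tiling adj R a' b"
    then show "f u' + f v' \<le> c"
      using edge.prems(1)[of u' v' "{#u, v#} + R" a] tiling.edge[of adj R a' b u v] edge.hyps
      by (simp add: add_mset_commute)
  next
    fix u' v' w' R b' assume "M = {#u', v', w'#} + R" "adj u' v'" "adj u' w'" "adj v' w'" "b = Suc b'" "tiling adj R a b'"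
    then show "f u' + f v' + f w' \<le> d"
      using edge.prems(2)[of u' v' w' "{#u, v#} + R" b'] tiling.edge[of adj R a b' u v] edge.hyps
      by (simp add: add_mset_commute)
  qed
  ultimately show ?case by simp
next
  case (triangle M a b u v w)
  have "f u + f v + f w \<le> d" using triangle.prems(2)[OF refl triangle.hyps(2-4) refl triangle.hyps(1)] .
  moreover have "(\<Sum>x\<in>#M. f x) \<le> a * c + b * d"
  proof (rule triangle.IH)
    fix u' v' R a' assume "M = {#u', v'#} + R" "adj u' v'" "a = Suc a'" "tiling adj R a' b"
    then show "f u' + f v' \<le> c"
      using triangle.prems(1)[of u' v' "{#u, v, w#} + R" a'] tiling.triangle[of adj R a' b u v w] triangle.hyps
      by (simp add: add_mset_commute)
  next
    fix u' v' w' R b' assume "M = {#u', v', w'#} + R" "adj u' v'" "adj u' w'" "adj v' w'" "b = Suc b'" "tiling adj R a b'"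
    then show "f u' + f v' + f w' \<le> d"
      using triangle.prems(2)[of u' v' w' "{#u, v, w#} + R" b] tiling.triangle[of adj R a b' u v w] triangle.hyps
      by (simp add: add_mset_commute)
  qed
  ultimately show ?case by simp
qed

lemma tiling_sum_ge:
  fixes f :: "'a \<Rightarrow> nat"
  assumes "tiling adj M a b" "b = 0"
    and "\<And>u v R a'. M = {#u, v#} + R \<Longrightarrow> adj u v \<Longrightarrow> a = Suc a' \<Longrightarrow> tiling adj R a' 0 \<Longrightarrow> c \<le> f u + f v"
  shows "a * c \<le> (\<Sum>x\<in>#M. f x)"
  using assms
proof induction
  case (edge M a b u v)
  have "c \<le> f u + f v" using edge.prems edge.hyps by blast
  moreover have "a * c \<le> (\<Sum>x\<in>#M. f x)"
  proof (rule edge.IH)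
    fix u' v' R a' assume "M = {#u', v'#} + R" "adj u' v'" "a = Suc a'" "tiling adj R a' 0"
    then show "c \<le> f u' + f v'"
      using edge.prems(2)[of u' v' "{#u, v#} + R" a] tiling.edge[of adj R a' 0 u v] edge.hyps
      by (simp add: add_mset_commute)
  qed (use edge.prems in simp)
  ultimately show ?case by simp
qed simp_all

section \<open>Degrees into a multiset\<close>

definition nbrs_in :: "('a \<Rightarrow> 'a \<Rightarrow> bool) \<Rightarrow> 'a \<Rightarrow> 'a multiset \<Rightarrow> nat" where
  "nbrs_in adj x M = (\<Sum>w\<in>#M. of_bool (adj x w))"

lemma nbrs_in_simps [simp]:
  "nbrs_in adj x {#} = 0"
  "nbrs_in adj x (add_mset y M) = of_bool (adj x y) + nbrs_in adj x M"
  "nbrs_in adj x (M + M') = nbrs_in adj x M + nbrs_in adj x M'"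
  by (simp_all add: nbrs_in_def)

text \<open>Double counting of the edges between \<open>A\<close> and \<open>B\<close>; it lets
  bounds per edge tile be compared with bounds per triangle tile.\<close>

lemma nbrs_in_swap:
  assumes "symp adj"
  shows "(\<Sum>x\<in>#A. nbrs_in adj x B) = (\<Sum>y\<in>#B. nbrs_in adj y A)"
proof (induction A)
  case empty
  then show ?case by (simp)
next
  case (add x A)
  have "nbrs_in adj x B = (\<Sum>y\<in>#B. of_bool (adj y x))"
    unfolding nbrs_in_def
    by (intro arg_cong[of _ _ sum_mset] image_mset_cong arg_cong[of _ _ of_bool]) (use assms in \<open>metis sympD\<close>)
  with add show ?case by (simp add: sum_mset.distrib)
qed

section \<open>Two vertices left over\<close>

text \<open>In terms of the numbers of tiles above, \<open>\<alpha> = a - 1\<close> and \<open>\<beta> = b - 1\<close>, so that \<open>k = \<alpha> + \<beta> + 2\<close>.\<close>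

locale untileable =
  fixes adj :: "'a \<Rightarrow> 'a \<Rightarrow> bool" and V :: "'a set" and \<alpha> \<beta> :: nat
  assumes sym: "symp adj" and irrefl: "\<not> adj x x" and finite_V: "finite V"
    and card_V: "card V = 2 * \<alpha> + 3 * \<beta> + 5"
    and degree: "x \<in> V \<Longrightarrow> \<alpha> + 2 * \<beta> + 2 \<le> nbrs_in adj x (mset_set V)"
    and independent: "I \<subseteq> V \<Longrightarrow> card I = \<alpha> + \<beta> + 3 \<Longrightarrow> \<exists>x\<in>I. \<exists>y\<in>I. x \<noteq> y \<and> adj x y"
    and nontrivial: "1 \<le> \<alpha> + \<beta>"
    and untileable: "\<not> tiling adj (mset_set V) (Suc \<alpha>) (Suc \<beta>)"
begin

abbreviation tiles where "tiles \<equiv> tiling adj"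
abbreviation nb where "nb \<equiv> nbrs_in adj"

lemma adj_commute: "adj x y \<longleftrightarrow> adj y x"
  using sym by (auto dest: sympD)

lemma in_V: "mset_set V = M \<Longrightarrow> x \<in># M \<Longrightarrow> x \<in> V"
  using finite_V by (metis elem_mset_set)

lemma degree': "mset_set V = M \<Longrightarrow> x \<in># M \<Longrightarrow> \<alpha> + 2 * \<beta> + 2 \<le> nb x M"
  using degree in_V by metis

text \<open>A vertex of minimum degree has 2\<alpha> + 3\<beta> + 5 - (\<alpha> + 2\<beta> + 2) = k
  + 1 nonneighbours, itself included, too many for an independent set. Both main cases end
  here.\<close>

lemma nonneighbours_not_independent:
  assumes "x \<in> V" "nb x (mset_set V) \<le> \<alpha> + 2 * \<beta> + 2"
  obtains y z where "y \<in> V" "z \<in> V" "\<not> adj x y" "\<not> adj x z" "y \<noteq> z" "adj y z"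
proof -
  have "nb x (mset_set V) = card {y \<in> V. adj x y}"
    unfolding nbrs_in_def using finite_V by (simp add: sum_unfold_sum_mset[symmetric] Int_def)
  moreover have "card {y \<in> V. adj x y} + card {y \<in> V. \<not> adj x y} = card V"
    using finite_V by (subst card_Un_disjoint[symmetric]) (auto intro: arg_cong[of _ _ card])
  moreover have "nb x (mset_set V) = \<alpha> + 2 * \<beta> + 2" using assms degree by (simp add: le_antisym)
  ultimately have "card {y \<in> V. \<not> adj x y} = \<alpha> + \<beta> + 3" using card_V by simp
  then show thesis using independent[of "{y \<in> V. \<not> adj x y}"] that by blast
qed

lemmas add_edge = tiling.edge[of adj] and add_triangle = tiling.triangle[of adj]

text \<open>The form in which exchanges are ruled out: \<open>add_edge\<close> and
  \<open>add_triangle\<close> build the new tiling, and only an equation of multisets and the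
  numbers of tiles remain.\<close>

lemma no_tiling:
  "mset_set V = M \<Longrightarrow> tiles M' a b \<Longrightarrow> M = M' \<Longrightarrow> a = Suc \<alpha> \<Longrightarrow> b = Suc \<beta> \<Longrightarrow> False"
  using untileable by simp

section \<open>Exchanges with two missed vertices\<close>

lemma two_singles_edge:
  assumes N: "mset_set V = {#x, y, u, v#} + R" and R: "tiles R a (Suc \<beta>)" and a: "\<alpha> = Suc a"
  shows "\<not> (adj x u \<and> adj y v)"
  by (rule notI, rule no_tiling[OF N add_edge[OF add_edge[OF R, of x u], of y v]])
    (use a in \<open>simp_all add: add_mset_commute\<close>)

text \<open>Otherwise the triangle \<open>x t1 t2\<close> and the edge \<open>y t3\<close> replace a
  triangle tile and cover \<open>x\<close> and \<open>y\<close>.\<close>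

lemma two_singles_triangle:
  assumes N: "mset_set V = {#x, y, t1, t2, t3#} + R" and R: "tiles R \<alpha> \<beta>"
    and t: "adj t1 t2"
  shows "\<not> (adj x t1 \<and> adj x t2 \<and> adj y t3)"
  by (rule notI, rule no_tiling[OF N add_edge[OF add_triangle[OF R, of x t1 t2], of y t3]])
    (use t in \<open>simp_all add: add_mset_commute\<close>)

text \<open>If one of \<open>x\<close>, \<open>y\<close> sees two vertices of the triangle, the
  other misses the third. Hence a sum of 4 is reached only when both see the same pair.\<close>

lemma two_singles_triangle_sum:
  assumes N: "mset_set V = {#x, y, t1, t2, t3#} + R" and R: "tiles R \<alpha> \<beta>"
    and t: "adj t1 t2" "adj t1 t3" "adj t2 t3"
  shows "nb x {#t1, t2, t3#} + nb y {#t1, t2, t3#} \<le> 4"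
    "4 \<le> nb x {#t1, t2, t3#} + nb y {#t1, t2, t3#} \<Longrightarrow>
      nb x {#t1, t2, t3#} = 2 \<and> (adj x t1 = adj y t1) \<and> (adj x t2 = adj y t2) \<and> (adj x t3 = adj y t3)"
proof -
  have N': "mset_set V = {#y, x, t1, t2, t3#} + R" "mset_set V = {#x, y, t1, t3, t2#} + R"
    "mset_set V = {#y, x, t1, t3, t2#} + R" "mset_set V = {#x, y, t2, t3, t1#} + R"
    "mset_set V = {#y, x, t2, t3, t1#} + R" using N by (simp_all add: add_mset_commute)
  note * = two_singles_triangle[OF N R t(1)] two_singles_triangle[OF N'(1) R t(1)]
    two_singles_triangle[OF N'(2) R t(2)] two_singles_triangle[OF N'(3) R t(2)]
    two_singles_triangle[OF N'(4) R t(3)] two_singles_triangle[OF N'(5) R t(3)]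
  show "nb x {#t1, t2, t3#} + nb y {#t1, t2, t3#} \<le> 4"
    using * by (cases "adj x t1"; cases "adj x t2"; cases "adj x t3"; cases "adj y t1"; cases "adj y t2"; cases "adj y t3"; simp)
  show "4 \<le> nb x {#t1, t2, t3#} + nb y {#t1, t2, t3#} \<Longrightarrow>
      nb x {#t1, t2, t3#} = 2 \<and> (adj x t1 = adj y t1) \<and> (adj x t2 = adj y t2) \<and> (adj x t3 = adj y t3)"
    using * by (cases "adj x t1"; cases "adj x t2"; cases "adj x t3"; cases "adj y t1"; cases "adj y t2"; cases "adj y t3"; simp)
qed

text \<open>At most 2 per edge tile and 4 per triangle tile. The tiles \<open>Q\<close> are set
  aside, so that bounding the rest forces a lower bound on their contribution.\<close>

lemma two_singles_sum:
  assumes N: "mset_set V = {#x, y#} + Q + R" and Q: "tiles Q c d" and R: "tiles R a b"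
    and ab: "c + a = \<alpha>" "d + b = Suc \<beta>"
  shows "nb x R + nb y R \<le> 2 * a + 4 * b"
proof -
  have "(\<Sum>w\<in>#R. of_bool (adj x w) + of_bool (adj y w)) \<le> a * 2 + b * (4 :: nat)"
  proof (rule tiling_sum_le[OF R])
    fix u v R' a' assume *: "R = {#u, v#} + R'" "adj u v" "a = Suc a'" "tiles R' a' b"
    have "tiles (Q + R') (c + a') (Suc \<beta>)" using tiling_add[OF Q *(4)] ab by simp
    moreover have "mset_set V = {#x, y, u, v#} + (Q + R')" "mset_set V = {#y, x, u, v#} + (Q + R')"
      using N * by (simp_all add: add_mset_commute)
    ultimately have "\<not> (adj x u \<and> adj y v)" "\<not> (adj y u \<and> adj x v)"
      using two_singles_edge[of x y u v "Q + R'" "c + a'"] two_singles_edge[of y x u v "Q + R'" "c + a'"]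
        ab * by auto
    then show "of_bool (adj x u) + of_bool (adj y u) + (of_bool (adj x v) + of_bool (adj y v)) \<le> (2 :: nat)"
      by (auto simp: of_bool_def)
  next
    fix u v w R' b' assume *: "R = {#u, v, w#} + R'" "adj u v" "adj u w" "adj v w" "b = Suc b'" "tiles R' a b'"
    have "tiles (Q + R') \<alpha> \<beta>" using tiling_add[OF Q *(6)] ab * by simp
    from two_singles_triangle_sum(1)[OF _ this *(2-4), of x y]
    show "of_bool (adj x u) + of_bool (adj y u) + (of_bool (adj x v) + of_bool (adj y v)) +
      (of_bool (adj x w) + of_bool (adj y w)) \<le> (4 :: nat)"
      using N * by (simp add: add_mset_commute)
  qed
  then show ?thesis by (simp add: nbrs_in_def sum_mset.distrib)
qed

text \<open>The degrees require at least 2\<alpha> + 4\<beta> + 4 edges from \<open>x\<close> and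
  \<open>y\<close> to the tiles, which is exactly the upper bound. So every tile attains its
  bound.\<close>

lemma two_singles_agree:
  assumes N: "mset_set V = {#x, y#} + R" and R: "tiles R \<alpha> (Suc \<beta>)"
  shows "\<not> adj x y" "\<And>r. r \<in># R \<Longrightarrow> adj x r = adj y r"
    "nb y (mset_set V) \<le> \<alpha> + 2 * \<beta> + 2"
    "\<And>u v R' a. R = {#u, v#} + R' \<Longrightarrow> adj u v \<Longrightarrow> \<alpha> = Suc a \<Longrightarrow> tiles R' a (Suc \<beta>) \<Longrightarrow> adj x u \<noteq> adj x v"
    "\<And>t1 t2 t3 R'. R = {#t1, t2, t3#} + R' \<Longrightarrow> adj t1 t2 \<Longrightarrow> adj t1 t3 \<Longrightarrow> adj t2 t3 \<Longrightarrow>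
      tiles R' \<alpha> \<beta> \<Longrightarrow> nb x {#t1, t2, t3#} = 2"
proof -
  show xy: "\<not> adj x y"
    using untileable add_edge[OF R] N by auto
  then have ge: "2 * \<alpha> + 4 * \<beta> + 4 \<le> nb x R + nb y R"
    using degree'[OF N, of x] degree'[OF N, of y] irrefl by (simp add: adj_commute)
  have tri: "nb x {#t1, t2, t3#} = 2 \<and> (adj x t1 = adj y t1) \<and> (adj x t2 = adj y t2) \<and> (adj x t3 = adj y t3)"
    if *: "R = {#t1, t2, t3#} + R'" "adj t1 t2" "adj t1 t3" "adj t2 t3" "tiles R' \<alpha> \<beta>" for t1 t2 t3 R'
  proof (rule two_singles_triangle_sum(2)[OF _ *(5,2-4)])
    show "mset_set V = {#x, y, t1, t2, t3#} + R'" using N * by simp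
    have "nb x R' + nb y R' \<le> 2 * \<alpha> + 4 * \<beta>"
      by (rule two_singles_sum[OF _ add_triangle[OF tiling.empty *(2-4)] *(5)]) (use N * in simp_all)
    then show "4 \<le> nb x {#t1, t2, t3#} + nb y {#t1, t2, t3#}" using ge * by simp
  qed
  obtain t1 t2 t3 S where t: "R = {#t1, t2, t3#} + S" "adj t1 t2" "adj t1 t3" "adj t2 t3" "tiles S \<alpha> \<beta>"
    using tiling_obtain_triangle[OF R] by metis
  \<comment> \<open>With 2 edges to an edge tile, one vertex might see both ends. Then
    \<open>z u v\<close> becomes a triangle tile, while \<open>z'\<close> and the vertices of a
    triangle tile are split into two edges.\<close>
  have both: "\<not> (adj z u \<and> adj z v)" if *: "R = {#u, v#} + R'" "adj u v" "\<alpha> = Suc a" "tiles R' a (Suc \<beta>)"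
    and z: "mset_set V = {#z, z'#} + R" "\<And>t1 t2 t3 R'. R = {#t1, t2, t3#} + R' \<Longrightarrow> adj t1 t2 \<Longrightarrow> adj t1 t3 \<Longrightarrow> adj t2 t3 \<Longrightarrow>
        tiles R' \<alpha> \<beta> \<Longrightarrow> nb z' {#t1, t2, t3#} = 2" for u v R' a z z'
  proof
    assume zuv: "adj z u \<and> adj z v"
    obtain t1 t2 t3 S where t: "R' = {#t1, t2, t3#} + S" "adj t1 t2" "adj t1 t3" "adj t2 t3" "tiles S a \<beta>"
      using tiling_obtain_triangle[OF *(4)] by metis
    have N': "mset_set V = {#z, z', u, v, t1, t2, t3#} + S" using z * t by simp
    have "nb z' {#t1, t2, t3#} = 2"
      by (rule z(2)[OF _ t(2-4) add_edge[OF t(5) *(2), folded *(3)]]) (use * t in \<open>simp add: add_mset_commute\<close>)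
    then have "adj z' t1 \<or> adj z' t2" by (cases "adj z' t1"; cases "adj z' t2"; cases "adj z' t3"; simp)
    then show False
    proof
      assume "adj z' t1" then show False
        by (intro no_tiling[OF N' add_triangle[OF add_edge[OF add_edge[OF t(5), of z' t1], of t2 t3], of z u v]])
          (use zuv * t in \<open>simp_all add: add_mset_commute\<close>)
    next
      assume "adj z' t2" then show False
        by (intro no_tiling[OF N' add_triangle[OF add_edge[OF add_edge[OF t(5), of z' t2], of t1 t3], of z u v]])
          (use zuv * t in \<open>simp_all add: add_mset_commute\<close>)
    qed
  qed
  have N2: "mset_set V = {#y, x#} + R" using N by (simp add: add_mset_commute)
  have tri': "nb y {#t1, t2, t3#} = 2"
    if *: "R = {#t1, t2, t3#} + R'" "adj t1 t2" "adj t1 t3" "adj t2 t3" "tiles R' \<alpha> \<beta>" for t1 t2 t3 R'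
    using tri[OF that] by (auto simp only: nbrs_in_simps)
  have tri0: "nb x {#t1, t2, t3#} = 2"
    if *: "R = {#t1, t2, t3#} + R'" "adj t1 t2" "adj t1 t3" "adj t2 t3" "tiles R' \<alpha> \<beta>" for t1 t2 t3 R'
    using tri[OF that] by (rule conjunct1)
  have edg: "adj x u = adj y u \<and> adj x u \<noteq> adj x v"
    if *: "R = {#u, v#} + R'" "adj u v" "\<alpha> = Suc a" "tiles R' a (Suc \<beta>)" for u v R' a
  proof -
    have "nb x R' + nb y R' \<le> 2 * a + 4 * Suc \<beta>"
      by (rule two_singles_sum[OF _ add_edge[OF tiling.empty *(2)] *(4)]) (use N * in simp_all)
    then have "2 \<le> nb x {#u, v#} + nb y {#u, v#}" using ge * by simp
    moreover have "\<not> (adj x u \<and> adj y v)" "\<not> (adj y u \<and> adj x v)"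
      using two_singles_edge[of x y u v R' a] two_singles_edge[of y x u v R' a] N N2 * by auto
    moreover have "\<not> (adj x u \<and> adj x v)" "\<not> (adj y u \<and> adj y v)"
      by (rule both[OF * N tri'], assumption+) (rule both[OF * N2 tri0], assumption+)
    ultimately show ?thesis by (cases "adj x u"; cases "adj x v"; cases "adj y u"; cases "adj y v"; simp)
  qed
  show "adj x r = adj y r" if "r \<in># R" for r
    using sym R that
  proof (cases rule: tiling_mem)
    case (edge w R' a)
    then show ?thesis using edg by metis
  next
    case (triangle u v R' b)
    then show ?thesis using tri by (metis nat.inject)
  qed
  then have "nb x R = nb y R"
    unfolding nbrs_in_def by (intro arg_cong[of _ _ sum_mset] image_mset_cong) simp
  moreover have "nb x R + nb y R \<le> 2 * \<alpha> + 4 * Suc \<beta>"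
    by (rule two_singles_sum[OF _ tiling.empty R]) (use N in simp_all)
  ultimately show "nb y (mset_set V) \<le> \<alpha> + 2 * \<beta> + 2"
    using N xy irrefl by (simp add: adj_commute)
  show "adj x u \<noteq> adj x v" if "R = {#u, v#} + R'" "adj u v" "\<alpha> = Suc a" "tiles R' a (Suc \<beta>)" for u v R' a
    using edg[OF that] by blast
  show "nb x {#t1, t2, t3#} = 2"
    if "R = {#t1, t2, t3#} + R'" "adj t1 t2" "adj t1 t3" "adj t2 t3" "tiles R' \<alpha> \<beta>" for t1 t2 t3 R'
    using tri[OF that] by blast
qed

lemma no_two_singles:
  assumes N: "mset_set V = {#x, y#} + R" and R: "tiles R \<alpha> (Suc \<beta>)"
  shows False
proof -
  note agree = two_singles_agree[OF N R]
  have V: "v \<in> V \<longleftrightarrow> v = x \<or> v = y \<or> v \<in># R" for v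
    using N finite_V by (metis elem_mset_set insert_iff set_mset_add_mset_insert union_mset_add_mset_left add_0)
  \<comment> \<open>Exchanging \<open>r\<close> with \<open>x\<close> leaves \<open>r\<close> and
    \<open>y\<close> missed. They agree on all vertices of the new tiles, in particular on
    \<open>s\<close>, which \<open>y\<close> does not see.\<close>
  have 1: "\<not> adj r s" if r: "r \<in># R" "\<not> adj y r" and s: "s \<in># R" "\<not> adj y s" "r \<noteq> s" for r s
    using sym R r(1)
  proof (cases rule: tiling_mem)
    case (edge w R' a)
    have w: "adj x w" using agree(4)[OF edge] agree(2)[OF r(1)] r(2) by blast
    have "mset_set V = {#r, y#} + ({#x, w#} + R')" using N edge by (simp add: add_mset_commute)
    moreover have "tiles ({#x, w#} + R') \<alpha> (Suc \<beta>)" using add_edge[OF edge(4) w] edge by simp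
    moreover have "s \<in># {#x, w#} + R'" using s w agree(2)[OF s(1)] edge by auto
    ultimately show ?thesis using two_singles_agree(2) s(2) by blast
  next
    case (triangle u v R' b)
    have w: "adj x u" "adj x v" using agree(5)[OF triangle(1-4)] triangle agree(2)[OF r(1)] r(2)
      by (cases "adj x u"; cases "adj x v"; simp)+
    have "mset_set V = {#r, y#} + ({#x, u, v#} + R')" using N triangle by (simp add: add_mset_commute)
    moreover have "tiles ({#x, u, v#} + R') \<alpha> (Suc \<beta>)" using add_triangle[OF triangle(6) w triangle(4)] triangle(5) by simp
    moreover have "s \<in># {#x, u, v#} + R'" using s w agree(2)[OF s(1)] triangle by auto
    ultimately show ?thesis using two_singles_agree(2) s(2) by blast
  qed
  have "y \<in> V" using V by simp
  then obtain r s where "r \<in> V" "s \<in> V" "\<not> adj y r" "\<not> adj y s" "r \<noteq> s" "adj r s"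
    using nonneighbours_not_independent agree(3) by metis
  then show False using 1 agree V adj_commute by metis
qed

section \<open>One vertex left over: counting edges between tiles\<close>

text \<open>The triangle would leave \<open>s\<close> and \<open>s'\<close> missed by \<alpha> edges
  and \<beta> + 1 triangles.\<close>

lemma no_triangle_among_five:
  assumes N: "mset_set V = {#p, q, r, s, s'#} + R" and R: "tiles R \<alpha> \<beta>"
    and "adj p q" "adj p r" "adj q r"
  shows False
  using no_two_singles[of s s' "{#p, q, r#} + R"] add_triangle[OF R assms(3-5)] N by (simp add: add_mset_commute)

lemma no_two_triangles_among_eight:
  assumes N: "mset_set V = {#p, q, r, p', q', r', s, s'#} + R" and R: "tiles R \<alpha> b" "\<beta> = Suc b"
    and "adj p q" "adj p r" "adj q r" "adj p' q'" "adj p' r'" "adj q' r'"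
  shows False
proof -
  have "tiles ({#p, q, r#} + ({#p', q', r'#} + R)) \<alpha> (Suc \<beta>)"
    using add_triangle[OF add_triangle[OF R(1) assms(7-9)] assms(4-6)] R(2) by simp
  then show False using no_two_singles[of s s' "{#p, q, r#} + ({#p', q', r'#} + R)"] N
    by (simp add: add_mset_commute)
qed

lemma single_edge:
  assumes N: "mset_set V = {#x, u, v#} + R" and R: "tiles R (Suc \<alpha>) \<beta>" and "adj u v"
  shows "\<not> (adj x u \<and> adj x v)"
  by (rule notI, rule no_tiling[OF N add_triangle[OF R, of x u v]]) (use assms in simp_all)

text \<open>Otherwise the triangles \<open>u v t1\<close> and \<open>x t2 t3\<close> replace an edge
  tile and a triangle tile and cover \<open>x\<close>.\<close>

lemma single_edge_triangle:
  assumes N: "mset_set V = {#x, u, v, t1, t2, t3#} + R" and R: "tiles R (Suc \<alpha>) b" "\<beta> = Suc b"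
    and "adj u v" "adj t2 t3"
  shows "\<not> (adj u t1 \<and> adj v t1 \<and> adj x t2 \<and> adj x t3)"
  by (rule notI, rule no_tiling[OF N add_triangle[OF add_triangle[OF R(1), of x t2 t3], of u v t1]])
     (use assms in \<open>simp_all add: add_mset_commute\<close>)

text \<open>The triangles \<open>u v t1\<close>, \<open>w z t2\<close> would leave \<open>x\<close>
  and \<open>t3\<close> missed; the triangles \<open>u v t1\<close>, \<open>w t2 t3\<close> would
  leave \<open>x\<close> and \<open>z\<close> missed.\<close>

lemma two_edges_triangle:
  assumes N: "mset_set V = {#x, u, v, w, z, t1, t2, t3#} + R" and R: "tiles R \<alpha> b" "\<beta> = Suc b"
    and adj: "adj u v" "adj w z" "adj t2 t3"
  shows "\<not> (adj u t1 \<and> adj v t1 \<and> adj w t2 \<and> adj z t2)"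
    "\<not> (adj u t1 \<and> adj v t1 \<and> adj w t2 \<and> adj w t3)"
proof -
  have "mset_set V = {#u, v, t1, w, z, t2, x, t3#} + R" "mset_set V = {#u, v, t1, w, t2, t3, x, z#} + R"
    using N by (simp_all add: add_mset_commute)
  from no_two_triangles_among_eight[OF this(1) R] no_two_triangles_among_eight[OF this(2) R]
  show "\<not> (adj u t1 \<and> adj v t1 \<and> adj w t2 \<and> adj z t2)"
    "\<not> (adj u t1 \<and> adj v t1 \<and> adj w t2 \<and> adj w t3)" using adj by blast+
qed

text \<open>Five edges from \<open>u v\<close> give two common neighbours in the triangle, so a
  common neighbour of \<open>w\<close> and \<open>z\<close> would differ from one of them. With six
  edges, \<open>w\<close> and \<open>z\<close> see at most one vertex each.\<close>

lemma two_edges_triangle_bound: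
  assumes N: "mset_set V = {#x, u, v, w, z, t1, t2, t3#} + R" and R: "tiles R \<alpha> b" "\<beta> = Suc b"
    and adj: "adj u v" "adj w z" "adj t1 t2" "adj t1 t3" "adj t2 t3"
  shows "5 \<le> nb u {#t1, t2, t3#} + nb v {#t1, t2, t3#} \<Longrightarrow> nb w {#t1, t2, t3#} + nb z {#t1, t2, t3#} \<le> 3"
    and "6 \<le> nb u {#t1, t2, t3#} + nb v {#t1, t2, t3#} \<Longrightarrow> nb w {#t1, t2, t3#} + nb z {#t1, t2, t3#} \<le> 2"
proof -
  \<comment> \<open>Stated for an arbitrary labeling of the triangle and then instantiated with its
    six permutations.\<close>
  have *: "\<not> (adj u t \<and> adj v t \<and> adj w t' \<and> adj z t')"
    "\<not> (adj u t \<and> adj v t \<and> adj w t' \<and> adj w t'')"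
    "\<not> (adj u t \<and> adj v t \<and> adj z t' \<and> adj z t'')"
    if "{#t, t', t''#} = {#t1, t2, t3#}" "adj t' t''" for t t' t''
  proof -
    have "mset_set V = {#x, u, v, w, z, t, t', t''#} + R" "mset_set V = {#x, u, v, z, w, t, t', t''#} + R"
      using N that(1) by (simp_all add: add_mset_commute)
    from two_edges_triangle[OF this(1) R adj(1,2) that(2)] two_edges_triangle[OF this(2) R adj(1) _ that(2)]
    show "\<not> (adj u t \<and> adj v t \<and> adj w t' \<and> adj z t')"
      "\<not> (adj u t \<and> adj v t \<and> adj w t' \<and> adj w t'')"
      "\<not> (adj u t \<and> adj v t \<and> adj z t' \<and> adj z t'')" using adj by (simp_all add: adj_commute)
  qed
  note 1 = *[OF refl adj(5)]
  have 2: "{#t2, t1, t3#} = {#t1, t2, t3#}" by (simp add: add_mset_commute)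
  note 2 = *[OF 2 adj(4)]
  have 3: "{#t3, t1, t2#} = {#t1, t2, t3#}" by (simp add: add_mset_commute)
  note 3 = *[OF 3 adj(3)]
  have 4: "{#t1, t3, t2#} = {#t1, t2, t3#}" by (simp add: add_mset_commute)
  have 5: "{#t2, t3, t1#} = {#t1, t2, t3#}" by (simp add: add_mset_commute)
  have 6: "{#t3, t2, t1#} = {#t1, t2, t3#}" by (simp add: add_mset_commute)
  note 4 = *(1)[OF 4] *(1)[OF 5] *(1)[OF 6]
  let ?c = "\<lambda>t. adj u t \<and> adj v t"
  let ?d = "\<lambda>t. adj w t \<and> adj z t"
  show "nb w {#t1, t2, t3#} + nb z {#t1, t2, t3#} \<le> 3" if 5: "5 \<le> nb u {#t1, t2, t3#} + nb v {#t1, t2, t3#}"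
  proof -
    from 5 have "?c t1 \<and> ?c t2 \<or> ?c t1 \<and> ?c t3 \<or> ?c t2 \<and> ?c t3"
      by (cases "adj u t1"; cases "adj u t2"; cases "adj u t3"; cases "adj v t1"; cases "adj v t2"; cases "adj v t3"; simp)
    then have "\<not> ?d t1" "\<not> ?d t2" "\<not> ?d t3" using 1 2 3 4 adj by (auto simp: adj_commute)
    then show ?thesis
      by (cases "adj w t1"; cases "adj w t2"; cases "adj w t3"; simp)
  qed
  show "nb w {#t1, t2, t3#} + nb z {#t1, t2, t3#} \<le> 2" if 6: "6 \<le> nb u {#t1, t2, t3#} + nb v {#t1, t2, t3#}"
  proof -
    from 6 have "adj u t1" "adj u t2" "adj u t3" "adj v t1" "adj v t2" "adj v t3"
      by (cases "adj u t1"; cases "adj u t2"; cases "adj u t3"; cases "adj v t1"; cases "adj v t2"; cases "adj v t3"; simp)+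
    then have "\<not> (adj w t2 \<and> adj w t3)" "\<not> (adj z t2 \<and> adj z t3)" "\<not> (adj w t1 \<and> adj w t3)" "\<not> (adj z t1 \<and> adj z t3)"
      "\<not> (adj w t2 \<and> adj w t1)" "\<not> (adj z t2 \<and> adj z t1)"
      using 1(2,3) 2(2,3) 3(2,3) by (auto simp: adj_commute)
    then show ?thesis
      by (cases "adj w t1"; cases "adj w t2"; cases "adj w t3"; cases "adj z t1"; cases "adj z t2"; cases "adj z t3"; simp)
  qed
qed

section \<open>Edge counts between the edge tiles and the triangle tiles\<close>

lemma nb_triangle_le: "nb u {#t1, t2, t3#} \<le> 3"
  by (cases "adj u t1"; cases "adj u t2"; cases "adj u t3"; simp)

text \<open>
  An edge tile that sends at least five edges to the triangle has two common neighbours in it, and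
  then no other edge tile has a common neighbour there.
\<close>

lemma edges_triangle_sum:
  assumes N: "mset_set V = {#x, t1, t2, t3#} + (A + R)"
    and adj: "adj t1 t2" "adj t1 t3" "adj t2 t3"
    and A: "tiles A (Suc (Suc \<alpha>)) 0" and R: "tiles R 0 b" "\<beta> = Suc b"
  shows "(\<Sum>w\<in>#A. nb w {#t1, t2, t3#}) \<le> 4 * (\<alpha> + 2)"
proof (cases "\<exists>u v A'. A = {#u, v#} + A' \<and> adj u v \<and> tiles A' (Suc \<alpha>) 0 \<and> 5 \<le> nb u {#t1, t2, t3#} + nb v {#t1, t2, t3#}")
  case True
  then obtain u v A' where uv: "A = {#u, v#} + A'" "adj u v" "tiles A' (Suc \<alpha>) 0"
    "5 \<le> nb u {#t1, t2, t3#} + nb v {#t1, t2, t3#}" by blast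
  have wz: "nb w {#t1, t2, t3#} + nb z {#t1, t2, t3#} \<le> 3"
    "6 \<le> nb u {#t1, t2, t3#} + nb v {#t1, t2, t3#} \<Longrightarrow> nb w {#t1, t2, t3#} + nb z {#t1, t2, t3#} \<le> 2"
    if *: "A' = {#w, z#} + A''" "adj w z" "tiles A'' \<alpha> 0" for w z A''
  proof -
    have "mset_set V = {#x, u, v, w, z, t1, t2, t3#} + (A'' + R)"
      using N uv * by (simp add: add_mset_commute)
    moreover have "tiles (A'' + R) \<alpha> b" using tiling_add[OF *(3) R(1)] by simp
    ultimately show "nb w {#t1, t2, t3#} + nb z {#t1, t2, t3#} \<le> 3"
      "6 \<le> nb u {#t1, t2, t3#} + nb v {#t1, t2, t3#} \<Longrightarrow> nb w {#t1, t2, t3#} + nb z {#t1, t2, t3#} \<le> 2"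
      using two_edges_triangle_bound R(2) uv * adj by metis+
  qed
  have 3: "(\<Sum>w\<in>#A'. nb w {#t1, t2, t3#}) \<le> Suc \<alpha> * 3 + 0 * 0"
    by (rule tiling_sum_le[OF uv(3)]) (use wz(1) in \<open>simp; metis\<close>)+
  \<comment> \<open>Both 5 + 3(\<alpha> + 1) and 6 + 2(\<alpha> + 1) are at most 4(\<alpha> +
    2).\<close>
  show ?thesis
  proof (cases "6 \<le> nb u {#t1, t2, t3#} + nb v {#t1, t2, t3#}")
    case True
    have "(\<Sum>w\<in>#A'. nb w {#t1, t2, t3#}) \<le> Suc \<alpha> * 2 + 0 * 0"
      by (rule tiling_sum_le[OF uv(3)]) (use wz(2)[OF _ _ _ True] in \<open>simp; metis\<close>)+
    then show ?thesis using uv(1) nb_triangle_le[of u t1 t2 t3] nb_triangle_le[of v t1 t2 t3] by (simp del: nbrs_in_simps)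
  next
    case False
    then show ?thesis using uv(1) 3 by (simp del: nbrs_in_simps)
  qed
next
  case False
  have "(\<Sum>w\<in>#A. nb w {#t1, t2, t3#}) \<le> Suc (Suc \<alpha>) * 4 + 0 * 0"
  proof (rule tiling_sum_le[OF A])
    fix u v R a' assume "A = {#u, v#} + R" "adj u v" "Suc (Suc \<alpha>) = Suc a'" "tiles R a' 0"
    then have "\<not> 5 \<le> nb u {#t1, t2, t3#} + nb v {#t1, t2, t3#}" using False by blast
    then show "nb u {#t1, t2, t3#} + nb v {#t1, t2, t3#} \<le> 4" by simp
  qed simp
  then show ?thesis by simp
qed

text \<open>A common neighbour of \<open>u\<close> and \<open>v\<close> in the triangle would form a
  triangle with them, and \<open>x\<close> one with the other two vertices. So each vertex of the
  triangle sees at most one end of \<open>u v\<close>.\<close>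

lemma edges_complete_triangle_sum:
  assumes N: "mset_set V = {#x, t1, t2, t3#} + (A + R)"
    and adj: "adj t1 t2" "adj t1 t3" "adj t2 t3" "adj x t1" "adj x t2" "adj x t3"
    and A: "tiles A (Suc (Suc \<alpha>)) 0" and R: "tiles R 0 b" "\<beta> = Suc b"
  shows "A = {#u, v#} + A' \<Longrightarrow> adj u v \<Longrightarrow> tiles A' (Suc \<alpha>) 0 \<Longrightarrow>
      nb u {#t1, t2, t3#} + nb v {#t1, t2, t3#} \<le> 3"
    "(\<Sum>w\<in>#A. nb w {#t1, t2, t3#}) \<le> 3 * (\<alpha> + 2)"
proof -
  have 1: "nb u {#t1, t2, t3#} + nb v {#t1, t2, t3#} \<le> 3"
    if *: "A = {#u, v#} + A'" "adj u v" "tiles A' (Suc \<alpha>) 0" for u v A'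
  proof -
    have "mset_set V = {#x, u, v, t1, t2, t3#} + (A' + R)" "mset_set V = {#x, u, v, t2, t1, t3#} + (A' + R)"
      "mset_set V = {#x, u, v, t3, t1, t2#} + (A' + R)"
      using N * by (simp_all add: add_mset_commute)
    moreover have "tiles (A' + R) (Suc \<alpha>) b" using tiling_add[OF *(3) R(1)] by simp
    ultimately have "\<not> (adj u t1 \<and> adj v t1)" "\<not> (adj u t2 \<and> adj v t2)" "\<not> (adj u t3 \<and> adj v t3)"
      using single_edge_triangle R(2) * adj by metis+
    then show ?thesis
      by (cases "adj u t1"; cases "adj u t2"; cases "adj u t3"; simp)
  qed
  then show "A = {#u, v#} + A' \<Longrightarrow> adj u v \<Longrightarrow> tiles A' (Suc \<alpha>) 0 \<Longrightarrow>
      nb u {#t1, t2, t3#} + nb v {#t1, t2, t3#} \<le> 3" by blast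
  have "(\<Sum>w\<in>#A. nb w {#t1, t2, t3#}) \<le> Suc (Suc \<alpha>) * 3 + 0 * 0"
    by (rule tiling_sum_le[OF A]) (use 1 in \<open>simp; metis\<close>)+
  then show "(\<Sum>w\<in>#A. nb w {#t1, t2, t3#}) \<le> 3 * (\<alpha> + 2)" by simp
qed

text \<open>A vertex of another edge tile seeing both \<open>u\<close> and \<open>v\<close> would
  give a triangle among five vertices. So the \<alpha> + 1 other tiles contribute at most 2 each,
  and the edge \<open>u v\<close> itself contributes 2.\<close>

lemma sum_nb_edges_le:
  assumes N: "mset_set V = add_mset x (A + B)" and A: "tiles A (Suc (Suc \<alpha>)) 0" and B: "tiles B 0 \<beta>"
    and uv: "A = {#u, v#} + A'" "adj u v" "tiles A' (Suc \<alpha>) 0"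
  shows "nb u A + nb v A \<le> 2 * \<alpha> + 4"
proof -
  have "(\<Sum>w\<in>#A'. nb w {#u, v#}) \<le> Suc \<alpha> * 2 + 0 * 0"
  proof (rule tiling_sum_le[OF uv(3)])
    fix w z A'' a' assume *: "A' = {#w, z#} + A''" "adj w z" "Suc \<alpha> = Suc a'" "tiles A'' a' 0"
    have "tiles (A'' + B) \<alpha> \<beta>" using tiling_add[OF *(4) B] * by simp
    moreover have "mset_set V = {#w, u, v, z, x#} + (A'' + B)" "mset_set V = {#z, u, v, w, x#} + (A'' + B)"
      using N uv * by (simp_all add: add_mset_commute)
    ultimately have "\<not> (adj w u \<and> adj w v)" "\<not> (adj z u \<and> adj z v)"
      using no_triangle_among_five uv(2) by blast+
    then show "nb w {#u, v#} + nb z {#u, v#} \<le> 2"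
      by (cases "adj w u"; cases "adj z u"; simp)
  qed simp
  then have "nb u A' + nb v A' \<le> 2 * \<alpha> + 2"
    using nbrs_in_swap[OF sym, of A' "{#u, v#}"] by simp
  then show ?thesis using uv irrefl by (simp add: adj_commute[of v u])
qed

text \<open>\<open>x\<close> sees at most one end of each edge tile. Letting \<open>B\<close>
  contain edge tiles as well allows one of them to be set aside.\<close>

lemma single_nb_edges_le:
  assumes N: "mset_set V = add_mset x (A + B)" and A: "tiles A a 0" and B: "tiles B b \<beta>"
    and ab: "a + b = \<alpha> + 2"
  shows "nb x A \<le> a"
proof -
  have "(\<Sum>w\<in>#A. of_bool (adj x w)) \<le> a * 1 + 0 * (0::nat)"
  proof (rule tiling_sum_le[OF A])
    fix w z A'' a' assume *: "A = {#w, z#} + A''" "adj w z" "a = Suc a'" "tiles A'' a' 0"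
    have "tiles (A'' + B) (Suc \<alpha>) \<beta>" using tiling_add[OF *(4) B] * ab by simp
    moreover have "mset_set V = {#x, w, z#} + (A'' + B)"
      using N * by (simp add: add_mset_commute)
    ultimately have "\<not> (adj x w \<and> adj x z)"
      using single_edge * by blast
    then show "of_bool (adj x w) + of_bool (adj x z) \<le> (1::nat)"
      by (cases "adj x w"; simp)
  qed simp
  then show ?thesis by (simp add: nbrs_in_def)
qed

lemma single_nb_triangles_ge:
  assumes N: "mset_set V = add_mset x (A + B)" and A: "tiles A (Suc (Suc \<alpha>)) 0" and B: "tiles B 0 \<beta>"
  shows "2 * \<beta> \<le> nb x B" "\<alpha> + 2 * \<beta> + 2 \<le> nb x A + nb x B"
proof -
  show "\<alpha> + 2 * \<beta> + 2 \<le> nb x A + nb x B" using degree'[OF N, of x] irrefl by simp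
  then show "2 * \<beta> \<le> nb x B" using single_nb_edges_le[OF N A B] by simp
qed

text \<open>The degrees of the ends of an edge tile sum to at least 2\<alpha> + 4\<beta> + 4, of
  which at most 2\<alpha> + 4 stays within \<open>A\<close>. So each edge tile sends at least
  4\<beta> edges to \<open>B\<close> and \<open>x\<close>.\<close>

lemma edges_triangles_sum_ge:
  assumes N: "mset_set V = add_mset x (A + B)" and A: "tiles A (Suc (Suc \<alpha>)) 0" and B: "tiles B 0 \<beta>"
  shows "(\<alpha> + 2) * (4 * \<beta>) \<le> (\<Sum>w\<in>#A. nb w B) + nb x A"
proof -
  have "Suc (Suc \<alpha>) * (4 * \<beta>) \<le> (\<Sum>w\<in>#A. nb w B + of_bool (adj x w))"
  proof (rule tiling_sum_ge[OF A refl])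
    fix u v A' a' assume *: "A = {#u, v#} + A'" "adj u v" "Suc (Suc \<alpha>) = Suc a'" "tiles A' a' 0"
    have "nb u A + nb v A \<le> 2 * \<alpha> + 4"
      using sum_nb_edges_le[OF N A B *(1,2)] * by simp
    moreover have "\<alpha> + 2 * \<beta> + 2 \<le> nb u (add_mset x (A + B))" "\<alpha> + 2 * \<beta> + 2 \<le> nb v (add_mset x (A + B))"
      using degree'[OF N, of u] degree'[OF N, of v] *(1) by simp_all
    ultimately show "4 * \<beta> \<le> nb u B + of_bool (adj x u) + (nb v B + of_bool (adj x v))"
      by (simp add: adj_commute[of x])
  qed
  then show ?thesis by (simp add: sum_mset.distrib nbrs_in_def)
qed

text \<open>Counted from the other side: each tile of \<open>B\<close> receives at most 4(\<alpha> +
  2) edges. The triangles of \<open>C\<close> are set aside.\<close>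

lemma edges_triangles_sum_le:
  assumes N: "mset_set V = add_mset x (A + (C + B))" and A: "tiles A (Suc (Suc \<alpha>)) 0" and B: "tiles B 0 b"
    and C: "tiles C 0 c" "c + b = \<beta>"
  shows "(\<Sum>w\<in>#A. nb w B) \<le> 4 * (\<alpha> + 2) * b"
proof -
  have "(\<Sum>t\<in>#B. nb t A) \<le> 0 * 0 + b * (4 * (\<alpha> + 2))"
  proof (rule tiling_sum_le[OF B])
    fix t1 t2 t3 B' b' assume *: "B = {#t1, t2, t3#} + B'" "adj t1 t2" "adj t1 t3" "adj t2 t3" "b = Suc b'" "tiles B' 0 b'"
    have "mset_set V = {#x, t1, t2, t3#} + (A + (C + B'))" using N * by (simp add: add_mset_commute)
    from edges_triangle_sum[OF this *(2-4) A] tiling_add[OF C(1) *(6)] C(2) *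
    have "(\<Sum>w\<in>#A. nb w {#t1, t2, t3#}) \<le> 4 * (\<alpha> + 2)" by simp
    then show "nb t1 A + nb t2 A + nb t3 A \<le> 4 * (\<alpha> + 2)"
      unfolding nbrs_in_swap[OF sym] by simp
  qed simp
  then show ?thesis unfolding nbrs_in_swap[OF sym] by (simp add: mult.commute)
qed

text \<open>A triangle complete to \<open>x\<close> receives only 3(\<alpha> + 2) edges from
  \<open>A\<close>, which is \<alpha> + 2 below the general bound. Only \<open>nb x A\<close>, at
  most \<alpha> + 2, can make up for this: so \<open>x\<close> has a neighbour in every edge tile,
  and a second such triangle is impossible.\<close>

lemma complete_triangle:
  assumes N: "mset_set V = {#x, t1, t2, t3#} + (A + B)" and A: "tiles A (Suc (Suc \<alpha>)) 0"
    and B: "tiles B 0 b" "\<beta> = Suc b"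
    and t: "adj t1 t2" "adj t1 t3" "adj t2 t3" and x: "adj x t1" "adj x t2" "adj x t3"
  shows "A = {#u, v#} + A' \<Longrightarrow> adj u v \<Longrightarrow> tiles A' (Suc \<alpha>) 0 \<Longrightarrow> adj x u \<noteq> adj x v"
    "B = {#s1, s2, s3#} + B' \<Longrightarrow> adj s1 s2 \<Longrightarrow> adj s1 s3 \<Longrightarrow> adj s2 s3 \<Longrightarrow> tiles B' 0 b' \<Longrightarrow> b = Suc b' \<Longrightarrow>
      \<not> (adj x s1 \<and> adj x s2 \<and> adj x s3)"
proof -
  let ?T = "{#t1, t2, t3#}"
  have T: "tiles ?T 0 1" using add_triangle[OF tiling.empty t] by simp
  have TB: "tiles (?T + B) 0 \<beta>" using tiling_add[OF T B(1)] B(2) by simp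
  have N': "mset_set V = add_mset x (A + (?T + B))" using N by (simp add: add_mset_commute)
  have ge: "(\<alpha> + 2) * (4 * \<beta>) \<le> (\<Sum>w\<in>#A. nb w ?T) + (\<Sum>w\<in>#A. nb w B) + nb x A"
    using edges_triangles_sum_ge[OF N' A TB] by (simp add: sum_mset.distrib)
  have le: "(\<Sum>w\<in>#A. nb w ?T) \<le> 3 * (\<alpha> + 2)"
    using edges_complete_triangle_sum(2)[OF N t x A B] .
  have xA: "nb x A \<le> \<alpha> + 2" using single_nb_edges_le[OF N' A TB] by simp
  have "(\<Sum>w\<in>#A. nb w B) \<le> 4 * (\<alpha> + 2) * b"
    using edges_triangles_sum_le[OF N' A B(1) T] B by simp
  moreover have "(\<alpha> + 2) * (4 * \<beta>) = 4 * (\<alpha> + 2) * b + 3 * (\<alpha> + 2) + (\<alpha> + 2)" unfolding B(2) by (simp add: algebra_simps)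
  ultimately have xA': "nb x A \<ge> \<alpha> + 2" using ge le by linarith
  show "adj x u \<noteq> adj x v" if *: "A = {#u, v#} + A'" "adj u v" "tiles A' (Suc \<alpha>) 0"
  proof -
    have "tiles ({#u, v#} + (?T + B)) 1 \<beta>" using add_edge[OF TB *(2)] by simp
    moreover have "mset_set V = add_mset x (A' + ({#u, v#} + (?T + B)))"
      using N * by (simp add: add_mset_commute)
    ultimately have "nb x A' \<le> Suc \<alpha>" using single_nb_edges_le[OF _ *(3)] by simp
    then have "nb x {#u, v#} \<ge> 1" using xA' * by simp
    moreover have "tiles (A' + (?T + B)) (Suc \<alpha>) \<beta>" using tiling_add[OF *(3) TB] by simp
    moreover have "mset_set V = {#x, u, v#} + (A' + (?T + B))" using N * by (simp add: add_mset_commute)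
    ultimately have "\<not> (adj x u \<and> adj x v)" "nb x {#u, v#} \<ge> 1" using single_edge *(2) by blast+
    then show ?thesis by (cases "adj x u"; cases "adj x v"; simp)
  qed
  show "\<not> (adj x s1 \<and> adj x s2 \<and> adj x s3)"
    if *: "B = {#s1, s2, s3#} + B'" "adj s1 s2" "adj s1 s3" "adj s2 s3" "tiles B' 0 b'" "b = Suc b'"
  proof
    assume s: "adj x s1 \<and> adj x s2 \<and> adj x s3"
    let ?S = "{#s1, s2, s3#}"
    have NS: "mset_set V = {#x, s1, s2, s3#} + (A + (?T + B'))" using N * by (simp add: add_mset_commute)
    have TB': "tiles (?T + B') 0 (Suc b')" using tiling_add[OF T *(5)] by simp
    have le': "(\<Sum>w\<in>#A. nb w ?S) \<le> 3 * (\<alpha> + 2)"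
      by (rule edges_complete_triangle_sum(2)[OF NS *(2-4) _ _ _ A TB']) (use s B(2) *(6) in simp_all)
    have "tiles (?S + ?T) 0 2" using tiling.triangle[OF T *(2-4)] by (simp add: numeral_2_eq_2)
    moreover have "mset_set V = add_mset x (A + ((?S + ?T) + B'))" using N * by (simp add: add_mset_commute)
    ultimately have "(\<Sum>w\<in>#A. nb w B') \<le> 4 * (\<alpha> + 2) * b'"
      using edges_triangles_sum_le[OF _ A *(5)] B * by simp
    moreover have "(\<Sum>w\<in>#A. nb w B) = (\<Sum>w\<in>#A. nb w ?S) + (\<Sum>w\<in>#A. nb w B')"
      unfolding *(1) nbrs_in_simps(3) by (simp only: sum_mset.distrib)
    \<comment> \<open>Arithmetic isolated in variables, with \<open>m\<close> for \<alpha> + 2: the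
      two triangles and \<open>x\<close> account for at most 7\<open>m\<close>, but
      8\<open>m\<close> is required.\<close>
    moreover have "q \<le> p + 7 * m"
      if "y \<le> p" "z = s + y" "q \<le> t + z + w" "t \<le> 3 * m" "s \<le> 3 * m" "w \<le> m" for p q m s t w y z :: nat
      using that by linarith
    ultimately have "(\<alpha> + 2) * (4 * \<beta>) \<le> 4 * (\<alpha> + 2) * b' + 7 * (\<alpha> + 2)" using ge le le' xA by blast
    moreover have "(\<alpha> + 2) * (4 * \<beta>) = 4 * (\<alpha> + 2) * b' + 8 * (\<alpha> + 2)"
      unfolding B(2) *(6) by (simp add: algebra_simps)
    ultimately show False by simp
  qed
qed

text \<open>At most two per triangle, and one more for the only triangle that may be complete to
  \<open>x\<close>.\<close>

lemma nb_triangles_le: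
  assumes N: "mset_set V = add_mset x (A + (C + B))" and A: "tiles A (Suc (Suc \<alpha>)) 0" and B: "tiles B 0 b"
    and C: "tiles C 0 c" "c + b = \<beta>"
  shows "nb x B \<le> 2 * b + 1"
    "(\<And>s1 s2 s3 B' b'. B = {#s1, s2, s3#} + B' \<Longrightarrow> adj s1 s2 \<Longrightarrow> adj s1 s3 \<Longrightarrow> adj s2 s3 \<Longrightarrow> tiles B' 0 b' \<Longrightarrow> b = Suc b' \<Longrightarrow>
      \<not> (adj x s1 \<and> adj x s2 \<and> adj x s3)) \<Longrightarrow> nb x B \<le> 2 * b"
proof -
  have *: "nb x B \<le> 2 * b" if "tiles B 0 b"
     "\<And>s1 s2 s3 B' b'. B = {#s1, s2, s3#} + B' \<Longrightarrow> adj s1 s2 \<Longrightarrow> adj s1 s3 \<Longrightarrow> adj s2 s3 \<Longrightarrow> tiles B' 0 b' \<Longrightarrow> b = Suc b' \<Longrightarrow>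
      \<not> (adj x s1 \<and> adj x s2 \<and> adj x s3)" for B b
  proof -
    have "(\<Sum>w\<in>#B. of_bool (adj x w)) \<le> 0 * 0 + b * (2::nat)"
    proof (rule tiling_sum_le[OF that(1)])
      fix u v w R b' assume "B = {#u, v, w#} + R" "adj u v" "adj u w" "adj v w" "b = Suc b'" "tiles R 0 b'"
      then have "\<not> (adj x u \<and> adj x v \<and> adj x w)" using that(2) by blast
      then show "of_bool (adj x u) + of_bool (adj x v) + of_bool (adj x w) \<le> (2::nat)"
        by (cases "adj x u"; cases "adj x v"; simp)
    qed simp
    then show ?thesis by (simp add: nbrs_in_def)
  qed
  from *[OF B] show "(\<And>s1 s2 s3 B' b'. B = {#s1, s2, s3#} + B' \<Longrightarrow> adj s1 s2 \<Longrightarrow> adj s1 s3 \<Longrightarrow> adj s2 s3 \<Longrightarrow> tiles B' 0 b' \<Longrightarrow> b = Suc b' \<Longrightarrow>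
      \<not> (adj x s1 \<and> adj x s2 \<and> adj x s3)) \<Longrightarrow> nb x B \<le> 2 * b" .
  show "nb x B \<le> 2 * b + 1"
  proof (cases "\<exists>t1 t2 t3 B' b'. B = {#t1, t2, t3#} + B' \<and> adj t1 t2 \<and> adj t1 t3 \<and> adj t2 t3 \<and> tiles B' 0 b' \<and> b = Suc b' \<and>
      adj x t1 \<and> adj x t2 \<and> adj x t3")
    case True
    then obtain t1 t2 t3 B' b' where t: "B = {#t1, t2, t3#} + B'" "adj t1 t2" "adj t1 t3" "adj t2 t3" "tiles B' 0 b'" "b = Suc b'"
      "adj x t1" "adj x t2" "adj x t3" by blast
    have N': "mset_set V = {#x, t1, t2, t3#} + (A + (C + B'))" using N t by (simp add: add_mset_commute)
    have CB: "tiles (C + B') 0 (c + b')" using tiling_add[OF C(1) t(5)] by simp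
    have \<beta>: "\<beta> = Suc (c + b')" using C(2) t(6) by simp
    have "nb x B' \<le> 2 * b'"
    proof (rule *[OF t(5)])
      fix s1 s2 s3 D b'' assume s: "B' = {#s1, s2, s3#} + D" "adj s1 s2" "adj s1 s3" "adj s2 s3" "tiles D 0 b''" "b' = Suc b''"
      have "C + B' = {#s1, s2, s3#} + (C + D)" "tiles (C + D) 0 (c + b'')" "c + b' = Suc (c + b'')"
        using s tiling_add[OF C(1) s(5)] by (simp_all add: add_mset_commute)
      from complete_triangle(2)[OF N' A CB \<beta> t(2-4) t(7-9) this(1) s(2-4) this(2,3)]
      show "\<not> (adj x s1 \<and> adj x s2 \<and> adj x s3)" .
    qed
    then show ?thesis using t by simp
  next
    case False
    then have "nb x B \<le> 2 * b" using *[OF B] by blast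
    then show ?thesis by simp
  qed
qed

section \<open>No triangle is complete to the left-over vertex\<close>

lemma complete_triangle_edge:
  assumes N: "mset_set V = {#x, t1, t2, t3, u, v#} + R" and R: "tiles R (Suc \<alpha>) b" "\<beta> = Suc b"
    and t: "adj t1 t2" "adj t1 t3" "adj t2 t3" and x: "adj x t1" "adj x t2" "adj x t3" and uv: "adj u v"
  shows "adj x u \<noteq> adj x v"
proof -
  obtain A B where AB: "R = A + B" "tiles A (Suc \<alpha>) 0" "tiles B 0 b" using tiling_split[OF R(1)] .
  show ?thesis
    by (rule complete_triangle(1)[OF _ add_edge[OF AB(2) uv] AB(3) R(2) t x refl uv AB(2)])
      (use N AB in \<open>simp add: add_mset_commute\<close>)
qed

lemma complete_triangle_unique:
  assumes N: "mset_set V = {#x, t1, t2, t3, s1, s2, s3#} + R" and R: "tiles R (Suc (Suc \<alpha>)) b" "\<beta> = Suc (Suc b)"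
    and t: "adj t1 t2" "adj t1 t3" "adj t2 t3" and x: "adj x t1" "adj x t2" "adj x t3"
    and s: "adj s1 s2" "adj s1 s3" "adj s2 s3"
  shows "\<not> (adj x s1 \<and> adj x s2 \<and> adj x s3)"
proof -
  obtain A B where AB: "R = A + B" "tiles A (Suc (Suc \<alpha>)) 0" "tiles B 0 b" using tiling_split[OF R(1)] .
  show ?thesis
    by (rule complete_triangle(2)[OF _ AB(2) add_triangle[OF AB(3) s] R(2) t x refl s AB(3) refl])
      (use N AB in \<open>simp add: add_mset_commute\<close>)
qed

section \<open>Edge tiles beside a complete graph on four vertices\<close>

definition clique4 :: "'a \<Rightarrow> 'a \<Rightarrow> 'a \<Rightarrow> 'a \<Rightarrow> bool" where
  "clique4 x1 x2 x3 x4 \<longleftrightarrow> adj x1 x2 \<and> adj x1 x3 \<and> adj x1 x4 \<and> adj x2 x3 \<and> adj x2 x4 \<and> adj x3 x4"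

definition star4 :: "'a \<Rightarrow> 'a \<Rightarrow> 'a \<Rightarrow> 'a \<Rightarrow> 'a \<Rightarrow> 'a \<Rightarrow> bool" where
  "star4 u v y1 y2 y3 y4 \<longleftrightarrow> adj u y1 \<and> adj u y2 \<and> adj u y3 \<and> \<not> adj u y4 \<and>
     \<not> adj v y1 \<and> \<not> adj v y2 \<and> \<not> adj v y3 \<and> adj v y4"

text \<open>The two edges share the exceptional vertex, which is the last argument of
  \<open>star4\<close>; the disjuncts run over its four choices.\<close>

definition same_star4 :: "'a \<Rightarrow> 'a \<Rightarrow> 'a \<Rightarrow> 'a \<Rightarrow> 'a \<Rightarrow> 'a \<Rightarrow> 'a \<Rightarrow> 'a \<Rightarrow> bool" where
  "same_star4 u v w z y1 y2 y3 y4 \<longleftrightarrow>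
     star4 u v y1 y2 y3 y4 \<and> star4 w z y1 y2 y3 y4 \<or>
     star4 u v y1 y2 y4 y3 \<and> star4 w z y1 y2 y4 y3 \<or>
     star4 u v y1 y3 y4 y2 \<and> star4 w z y1 y3 y4 y2 \<or>
     star4 u v y2 y3 y4 y1 \<and> star4 w z y2 y3 y4 y1"

definition big4 :: "'a \<Rightarrow> 'a \<Rightarrow> 'a \<Rightarrow> 'a \<Rightarrow> 'a \<Rightarrow> bool" where
  "big4 u y1 y2 y3 y4 \<longleftrightarrow>
     adj u y1 \<and> adj u y2 \<and> adj u y3 \<or> adj u y1 \<and> adj u y2 \<and> adj u y4 \<or>
     adj u y1 \<and> adj u y3 \<and> adj u y4 \<or> adj u y2 \<and> adj u y3 \<and> adj u y4"

text \<open>Each vertex of the clique can be the left-over one, with the other three as a triangle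
  tile complete to it.\<close>

lemma clique4_edge_exact:
  assumes N: "mset_set V = {#x1, x2, x3, x4, u, v#} + R" and R: "tiles R (Suc \<alpha>) b" "\<beta> = Suc b"
    and K: "clique4 x1 x2 x3 x4" and uv: "adj u v"
  shows "adj u x1 \<noteq> adj v x1" "adj u x2 \<noteq> adj v x2" "adj u x3 \<noteq> adj v x3" "adj u x4 \<noteq> adj v x4"
proof -
  note k = K[unfolded clique4_def]
  have N': "mset_set V = {#x2, x1, x3, x4, u, v#} + R" "mset_set V = {#x3, x1, x2, x4, u, v#} + R"
     "mset_set V = {#x4, x1, x2, x3, u, v#} + R" using N by (simp_all add: add_mset_commute)
  show "adj u x1 \<noteq> adj v x1" using complete_triangle_edge[OF N R _ _ _ _ _ _ uv] k by (simp add: adj_commute)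
  show "adj u x2 \<noteq> adj v x2" using complete_triangle_edge[OF N'(1) R _ _ _ _ _ _ uv] k by (simp add: adj_commute)
  show "adj u x3 \<noteq> adj v x3" using complete_triangle_edge[OF N'(2) R _ _ _ _ _ _ uv] k by (simp add: adj_commute)
  show "adj u x4 \<noteq> adj v x4" using complete_triangle_edge[OF N'(3) R _ _ _ _ _ _ uv] k by (simp add: adj_commute)
qed

lemma two_pairs_one_edge:
  assumes N: "mset_set V = {#x1, x2, x3, x4, u, v#} + R" and R: "tiles R (Suc \<alpha>) b" "\<beta> = Suc b"
    and K: "adj x1 x2" "adj x3 x4"
  shows "\<not> (adj u x1 \<and> adj u x2 \<and> adj v x3 \<and> adj v x4)"
  by (rule notI, rule no_tiling[OF N add_triangle[OF add_triangle[OF R(1), of u x1 x2], of v x3 x4]])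
    (use R K in \<open>simp_all add: add_mset_commute\<close>)

lemma two_pairs_two_edges:
  assumes N: "mset_set V = {#x1, x2, x3, x4, u, v, w, z#} + R" and R: "tiles R \<alpha> b" "\<beta> = Suc b"
    and K: "adj x1 x2" "adj x3 x4"
  shows "\<not> (adj u x1 \<and> adj u x2 \<and> adj w x3 \<and> adj w x4)"
proof -
  have "mset_set V = {#u, x1, x2, w, x3, x4, v, z#} + R" using N by (simp_all add: add_mset_commute)
  from no_two_triangles_among_eight[OF this R] K show ?thesis by blast
qed

text \<open>By exactness the four vertices are divided between \<open>u\<close> and
  \<open>v\<close>, and a division into two pairs would give two triangles that complete a
  tiling.\<close>

lemma clique4_big:
  assumes N: "mset_set V = {#x1, x2, x3, x4, u, v#} + R" and R: "tiles R (Suc \<alpha>) b" "\<beta> = Suc b"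
    and K: "clique4 x1 x2 x3 x4" and uv: "adj u v"
  shows "big4 u x1 x2 x3 x4 \<or> big4 v x1 x2 x3 x4"
proof -
  note k = K[unfolded clique4_def]
  have N': "mset_set V = {#x1, x3, x2, x4, u, v#} + R" "mset_set V = {#x1, x4, x2, x3, u, v#} + R"
     "mset_set V = {#x2, x3, x1, x4, u, v#} + R" "mset_set V = {#x2, x4, x1, x3, u, v#} + R"
     "mset_set V = {#x3, x4, x1, x2, u, v#} + R" using N by (simp_all add: add_mset_commute)
  note two = two_pairs_one_edge[OF N R] two_pairs_one_edge[OF N'(1) R] two_pairs_one_edge[OF N'(2) R]
    two_pairs_one_edge[OF N'(3) R] two_pairs_one_edge[OF N'(4) R] two_pairs_one_edge[OF N'(5) R]
  show ?thesis unfolding big4_def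
    using clique4_edge_exact[OF N R K uv] two k by argo
qed

text \<open>Two sets of at least three among four vertices contain disjoint pairs unless they are
  the same three-element set. Disjoint pairs give two triangles that leave \<open>v\<close> and
  \<open>z\<close> missed. Exactness then determines the neighbours of \<open>v\<close> and
  \<open>z\<close>.\<close>

lemma clique4_big_same:
  assumes N: "mset_set V = {#x1, x2, x3, x4, u, v, w, z#} + R" and R: "tiles R \<alpha> b" "\<beta> = Suc b"
    and K: "clique4 x1 x2 x3 x4" and uv: "adj u v" and wz: "adj w z"
    and big: "big4 u x1 x2 x3 x4" "big4 w x1 x2 x3 x4"
  shows "same_star4 u v w z x1 x2 x3 x4"
proof -
  note k = K[unfolded clique4_def]
  have N': "mset_set V = {#x1, x3, x2, x4, u, v, w, z#} + R" "mset_set V = {#x1, x4, x2, x3, u, v, w, z#} + R"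
     "mset_set V = {#x2, x3, x1, x4, u, v, w, z#} + R" "mset_set V = {#x2, x4, x1, x3, u, v, w, z#} + R"
     "mset_set V = {#x3, x4, x1, x2, u, v, w, z#} + R" using N by (simp_all add: add_mset_commute)
  note two = two_pairs_two_edges[OF N R] two_pairs_two_edges[OF N'(1) R] two_pairs_two_edges[OF N'(2) R]
    two_pairs_two_edges[OF N'(3) R] two_pairs_two_edges[OF N'(4) R] two_pairs_two_edges[OF N'(5) R]
  have "mset_set V = {#x1, x2, x3, x4, u, v#} + ({#w, z#} + R)" "mset_set V = {#x1, x2, x3, x4, w, z#} + ({#u, v#} + R)"
     using N by (simp_all add: add_mset_commute)
  note ex = clique4_edge_exact[OF this(1) add_edge[OF R(1) wz] R(2) K uv]
    clique4_edge_exact[OF this(2) add_edge[OF R(1) uv] R(2) K wz]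
  have "adj u x1 \<and> adj u x2 \<and> adj u x3 \<and> \<not> adj u x4 \<and> adj w x1 \<and> adj w x2 \<and> adj w x3 \<and> \<not> adj w x4 \<or>
    adj u x1 \<and> adj u x2 \<and> \<not> adj u x3 \<and> adj u x4 \<and> adj w x1 \<and> adj w x2 \<and> \<not> adj w x3 \<and> adj w x4 \<or>
    adj u x1 \<and> \<not> adj u x2 \<and> adj u x3 \<and> adj u x4 \<and> adj w x1 \<and> \<not> adj w x2 \<and> adj w x3 \<and> adj w x4 \<or>
    \<not> adj u x1 \<and> adj u x2 \<and> adj u x3 \<and> adj u x4 \<and> \<not> adj w x1 \<and> adj w x2 \<and> adj w x3 \<and> adj w x4"
    using big two k unfolding big4_def by argo
  then show ?thesis using ex unfolding same_star4_def star4_def by argo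
qed

lemma clique4_same_star4:
  assumes N: "mset_set V = {#x1, x2, x3, x4, u, v, w, z#} + R" and R: "tiles R \<alpha> b" "\<beta> = Suc b"
    and K: "clique4 x1 x2 x3 x4" and uv: "adj u v" and wz: "adj w z"
  shows "same_star4 u v w z x1 x2 x3 x4 \<or> same_star4 v u w z x1 x2 x3 x4 \<or>
    same_star4 u v z w x1 x2 x3 x4 \<or> same_star4 v u z w x1 x2 x3 x4"
proof -
  have N': "mset_set V = {#x1, x2, x3, x4, v, u, w, z#} + R" "mset_set V = {#x1, x2, x3, x4, u, v, z, w#} + R"
    "mset_set V = {#x1, x2, x3, x4, v, u, z, w#} + R" using N by (simp_all add: add_mset_commute)
  have "mset_set V = {#x1, x2, x3, x4, u, v#} + ({#w, z#} + R)" "mset_set V = {#x1, x2, x3, x4, w, z#} + ({#u, v#} + R)"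
     using N by (simp_all add: add_mset_commute)
  from clique4_big[OF this(1) add_edge[OF R(1) wz] R(2) K uv] clique4_big[OF this(2) add_edge[OF R(1) uv] R(2) K wz]
  show ?thesis
    using clique4_big_same[OF N R K uv wz] clique4_big_same[OF N'(1) R K _ wz]
      clique4_big_same[OF N'(2) R K uv] clique4_big_same[OF N'(3) R K] uv wz adj_commute by metis
qed

text \<open>
  With \<open>v1\<close> left over instead, some triangle \<open>z1 z2 z3\<close> is complete to \<open>v1\<close>.  Comparing the two
  complete graphs on four vertices, \<open>v2\<close> has only one neighbour in this triangle and only one in
  \<open>u2 x1 x2\<close>, which is too few when \<open>v2\<close> is the vertex left over.
\<close>

lemma no_star4_clique4:
  assumes N: "mset_set V = {#x1, x2, x3, x4, u1, v1, u2, v2#} + R" and R: "tiles R \<alpha> b" "\<beta> = Suc b"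
    and K: "clique4 x1 x2 x3 x4" and uv: "adj u1 v1" "adj u2 v2"
    and star: "star4 u1 v1 x1 x2 x3 x4" "star4 u2 v2 x1 x2 x3 x4"
  shows False
proof -
  note k = K[unfolded clique4_def] star[unfolded star4_def]
  obtain A B where AB: "R = A + B" "tiles A \<alpha> 0" "tiles B 0 b" using tiling_split[OF R(1)] .
  have tu: "adj u1 x1" "adj u1 x2" "adj x1 x2" "adj u2 x1" "adj u2 x2" "adj x3 x4" using k by simp_all
  have tA1: "tiles ({#x3, x4#} + ({#u2, v2#} + A)) (Suc (Suc \<alpha>)) 0"
    using add_edge[OF add_edge[OF AB(2) uv(2)] tu(6)] .
  have tB1: "tiles ({#u1, x1, x2#} + B) 0 \<beta>" using add_triangle[OF AB(3) tu(1-3)] R(2) by simp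
  have N1: "mset_set V = add_mset v1 (({#x3, x4#} + ({#u2, v2#} + A)) + ({#u1, x1, x2#} + B))"
    using N AB by (simp add: add_mset_commute)
  have v1: "nb v1 {#u1, x1, x2#} = 1" using k uv by (simp add: adj_commute)
  have tC1: "tiles {#u1, x1, x2#} 0 1" using add_triangle[OF tiling.empty tu(1-3)] by simp
  \<comment> \<open>\<open>v1\<close> needs 2\<beta> = 2b + 2 neighbours in the triangle tiles and
    sees only \<open>u1\<close> in \<open>u1 x1 x2\<close>. So at least 2b + 1 lie in the b tiles of
    \<open>B\<close>, and one of these is complete to \<open>v1\<close>.\<close>
  have "\<not> nb v1 B \<le> 2 * b"
    using single_nb_triangles_ge(1)[OF N1 tA1 tB1] v1 R(2) by simp
  have "\<exists>z1 z2 z3 B1 b1. B = {#z1, z2, z3#} + B1 \<and> adj z1 z2 \<and> adj z1 z3 \<and> adj z2 z3 \<and> tiles B1 0 b1 \<and> b = Suc b1 \<and>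
    adj v1 z1 \<and> adj v1 z2 \<and> adj v1 z3"
  proof (rule ccontr)
    assume "\<not> ?thesis"
    then have "nb v1 B \<le> 2 * b"
      using R(2) by (intro nb_triangles_le(2)[OF N1 tA1 AB(3) tC1]) (simp, blast)
    with \<open>\<not> nb v1 B \<le> 2 * b\<close> show False ..
  qed
  then obtain z1 z2 z3 B1 b1 where
    z: "B = {#z1, z2, z3#} + B1" "adj z1 z2" "adj z1 z3" "adj z2 z3" "tiles B1 0 b1" "b = Suc b1"
    "adj v1 z1" "adj v1 z2" "adj v1 z3" by blast
  have NK: "mset_set V = {#v1, z1, z2, z3, x3, x4, u2, v2#} + (A + ({#u1, x1, x2#} + B1))"
    using N AB z by (simp add: add_mset_commute)
  have "tiles (A + ({#u1, x1, x2#} + B1)) \<alpha> (Suc b1)"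
    using tiling_add[OF AB(2) add_triangle[OF z(5) tu(1-3)]] by simp
  from clique4_same_star4[OF NK this _ _ tu(6) uv(2)] z R(2)
  have "same_star4 x3 x4 u2 v2 v1 z1 z2 z3 \<or> same_star4 x4 x3 u2 v2 v1 z1 z2 z3 \<or>
    same_star4 x3 x4 v2 u2 v1 z1 z2 z3 \<or> same_star4 x4 x3 v2 u2 v1 z1 z2 z3"
    by (simp add: clique4_def)
  moreover have "\<not> adj x3 v1" "adj x4 v1" using k by (simp_all add: adj_commute)
  \<comment> \<open>If \<open>x3\<close> has three neighbours in the clique, they are
    \<open>z1\<close>, \<open>z2\<close>, \<open>z3\<close>. Otherwise \<open>v1\<close> is among
    the three neighbours of \<open>x4\<close>, and these are also the neighbours of
    \<open>v2\<close> or of \<open>u2\<close>; in the latter case \<open>v2\<close> keeps just one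
    vertex of the triangle.\<close>
  ultimately consider "adj x3 z1" "adj x3 z2" "adj x3 z3" | "adj v2 v1" | "nb v2 {#z1, z2, z3#} = 1"
    unfolding same_star4_def star4_def by auto
  then show False
  proof cases
    case 1
    have Nx: "mset_set V = {#x3, x1, x2, x4, z1, z2, z3#} + ({#u1, v1#} + ({#u2, v2#} + (A + B1)))"
      using N AB z by (simp add: add_mset_commute)
    have tx: "tiles ({#u1, v1#} + ({#u2, v2#} + (A + B1))) (Suc (Suc \<alpha>)) b1"
      using add_edge[OF add_edge[OF tiling_add[OF AB(2) z(5)] uv(2)] uv(1)] by simp
    have "\<not> (adj x3 z1 \<and> adj x3 z2 \<and> adj x3 z3)"
      by (rule complete_triangle_unique[OF Nx tx]) (use z k R(2) in \<open>simp_all add: adj_commute\<close>)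
    with 1 show False by blast
  next
    case 2
    have "mset_set V = {#x4, v1, v2, u1, u2#} + ({#x1, x2, x3#} + R)"
      using N by (simp add: add_mset_commute)
    moreover have "tiles ({#x1, x2, x3#} + R) \<alpha> \<beta>" using add_triangle[OF R(1)] R(2) k by simp
    ultimately show False using no_triangle_among_five 2 k adj_commute by metis
  next
    case 3
    have tA2: "tiles ({#x3, x4#} + ({#u1, v1#} + A)) (Suc (Suc \<alpha>)) 0"
      using add_edge[OF add_edge[OF AB(2) uv(1)] tu(6)] .
    have N2: "mset_set V = add_mset v2 (({#x3, x4#} + ({#u1, v1#} + A)) + (({#u2, x1, x2#} + {#z1, z2, z3#}) + B1))"
      using N AB z by (simp add: add_mset_commute)
    have tC2: "tiles ({#u2, x1, x2#} + {#z1, z2, z3#}) 0 2"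
      using tiling_add[OF add_triangle[OF tiling.empty tu(4,5,3)] add_triangle[OF tiling.empty z(2-4)]] by (simp add: numeral_2_eq_2)
    have \<beta>: "2 + b1 = \<beta>" using z R by simp
    have "nb v2 {#u2, x1, x2#} = 1" using k uv by (simp add: adj_commute)
    moreover have "nb v2 B1 \<le> 2 * b1 + 1" using nb_triangles_le(1)[OF N2 tA2 z(5) tC2 \<beta>] .
    moreover have "tiles (({#u2, x1, x2#} + {#z1, z2, z3#}) + B1) 0 \<beta>" using tiling_add[OF tC2 z(5)] \<beta> by simp
    note single_nb_triangles_ge(1)[OF N2 tA2 this]
    \<comment> \<open>The total is at most 1 + 1 + (2 b1 + 1), one short of 2\<beta> = 2 b1 +
      4.\<close>
    ultimately show False using 3 \<beta> by (simp only: nbrs_in_simps(3))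
  qed
qed

text \<open>There are at least two edge tiles, and they split the clique \<open>x t1 t2 t3\<close>
  in the same way; up to renumbering this is the situation of
  \<open>no_star4_clique4\<close>.\<close>

lemma no_complete_triangle:
  assumes N: "mset_set V = {#x, t1, t2, t3#} + R" and R: "tiles R (Suc (Suc \<alpha>)) b" "\<beta> = Suc b"
    and t: "adj t1 t2" "adj t1 t3" "adj t2 t3"
  shows "\<not> (adj x t1 \<and> adj x t2 \<and> adj x t3)"
proof
  assume x: "adj x t1 \<and> adj x t2 \<and> adj x t3"
  then have K: "clique4 x t1 t2 t3" using t by (simp add: clique4_def)
  obtain p q R' where pq: "R = {#p, q#} + R'" "adj p q" "tiles R' (Suc \<alpha>) b" using tiling_obtain_edge[OF R(1)] .
  obtain r s S where rs: "R' = {#r, s#} + S" "adj r s" "tiles S \<alpha> b" using tiling_obtain_edge[OF pq(3)] .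
  have star: False if "same_star4 u v w z y1 y2 y3 y4" "mset_set V = {#y1, y2, y3, y4, u, v, w, z#} + S"
    "adj u v" "adj w z" "clique4 y1 y2 y3 y4" for u v w z y1 y2 y3 y4
  proof -
    have "mset_set V = {#y1, y2, y4, y3, u, v, w, z#} + S" "mset_set V = {#y1, y3, y4, y2, u, v, w, z#} + S"
      "mset_set V = {#y2, y3, y4, y1, u, v, w, z#} + S" using that(2) by (simp_all add: add_mset_commute)
    moreover have "clique4 y1 y2 y4 y3" "clique4 y1 y3 y4 y2" "clique4 y2 y3 y4 y1"
      using that(5) by (auto simp: clique4_def adj_commute)
    ultimately show False using no_star4_clique4[OF _ rs(3) R(2) _ that(3,4)] that(1,2,5)
      unfolding same_star4_def by blast
  qed
  have "mset_set V = {#x, t1, t2, t3, p, q, r, s#} + S" "mset_set V = {#x, t1, t2, t3, q, p, r, s#} + S"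
    "mset_set V = {#x, t1, t2, t3, p, q, s, r#} + S" "mset_set V = {#x, t1, t2, t3, q, p, s, r#} + S"
    using N pq rs by (simp_all add: add_mset_commute)
  then show False using clique4_same_star4[OF _ rs(3) R(2) K pq(2) rs(2)] star K pq(2) rs(2) adj_commute by metis
qed

section \<open>Exact numbers of neighbours of the left-over vertex\<close>

text \<open>Without complete triangles the upper bounds \<alpha> + 2 and 2\<beta> add up to the
  minimum degree, so both are attained.\<close>

lemma single_nb_exact:
  assumes N: "mset_set V = add_mset x (A + B)" and A: "tiles A (Suc (Suc \<alpha>)) 0" and B: "tiles B 0 \<beta>"
  shows "nb x A = \<alpha> + 2" "nb x B = 2 * \<beta>" "nb x (mset_set V) \<le> \<alpha> + 2 * \<beta> + 2"
proof -
  have *: "mset_set V = add_mset x (A + ({#} + B))" using N by simp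
  have "nb x B \<le> 2 * \<beta>"
  proof (rule nb_triangles_le(2)[OF * A B tiling.empty])
    fix s1 s2 s3 B' b' assume s: "B = {#s1, s2, s3#} + B'" "adj s1 s2" "adj s1 s3" "adj s2 s3" "tiles B' 0 b'" "\<beta> = Suc b'"
    have "mset_set V = {#x, s1, s2, s3#} + (A + B')" using N s by (simp add: add_mset_commute)
    moreover have "tiles (A + B') (Suc (Suc \<alpha>)) b'" using tiling_add[OF A s(5)] by simp
    ultimately show "\<not> (adj x s1 \<and> adj x s2 \<and> adj x s3)" using no_complete_triangle s by metis
  qed simp
  moreover have "nb x A \<le> \<alpha> + 2" using single_nb_edges_le[OF N A B] by simp
  ultimately show "nb x A = \<alpha> + 2" "nb x B = 2 * \<beta>" "nb x (mset_set V) \<le> \<alpha> + 2 * \<beta> + 2"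
    using single_nb_triangles_ge[OF N A B] N irrefl by simp_all
qed

text \<open>The total over all edge tiles is attained while the others give at most \<alpha> + 1, so
  this tile contributes.\<close>

lemma single_edge_exact:
  assumes N: "mset_set V = {#x, u, v#} + R" and R: "tiles R (Suc \<alpha>) \<beta>" and uv: "adj u v"
  shows "adj x u \<noteq> adj x v"
proof -
  obtain A B where AB: "R = A + B" "tiles A (Suc \<alpha>) 0" "tiles B 0 \<beta>" using tiling_split[OF R(1)] .
  have "mset_set V = add_mset x (({#u, v#} + A) + B)" using N AB by (simp add: add_mset_commute)
  from single_nb_exact(1)[OF this add_edge[OF AB(2) uv] AB(3)] have 1: "nb x ({#u, v#} + A) = \<alpha> + 2" .
  have "mset_set V = add_mset x (A + ({#u, v#} + B))" using N AB by (simp add: add_mset_commute)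
  from single_nb_edges_le[OF this AB(2) add_edge[OF AB(3) uv]] have "nb x A \<le> \<alpha> + 1" by simp
  with 1 have "nb x {#u, v#} \<ge> 1" by simp
  then show ?thesis using single_edge[OF N R uv] by (cases "adj x u"; cases "adj x v"; simp)
qed

lemma single_triangle_exact:
  assumes N: "mset_set V = {#x, t1, t2, t3#} + R" and R: "tiles R (Suc (Suc \<alpha>)) b" "\<beta> = Suc b"
    and t: "adj t1 t2" "adj t1 t3" "adj t2 t3"
  shows "nb x {#t1, t2, t3#} = 2"
proof -
  obtain A B where AB: "R = A + B" "tiles A (Suc (Suc \<alpha>)) 0" "tiles B 0 b" using tiling_split[OF R(1)] .
  have N': "mset_set V = add_mset x (A + ({#t1, t2, t3#} + B))" using N AB by (simp add: add_mset_commute)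
  from single_nb_exact(2)[OF N' AB(2) add_triangle[OF AB(3) t, folded R(2)]]
  have 1: "nb x ({#t1, t2, t3#} + B) = 2 * \<beta>" .
  have "nb x B \<le> 2 * b"
  proof (rule nb_triangles_le(2)[OF N' AB(2,3)])
    show "tiles {#t1, t2, t3#} 0 1" using add_triangle[OF tiling.empty t] by simp
  next
    fix s1 s2 s3 B' b' assume s: "B = {#s1, s2, s3#} + B'" "adj s1 s2" "adj s1 s3" "adj s2 s3" "tiles B' 0 b'" "b = Suc b'"
    have "mset_set V = {#x, s1, s2, s3#} + ({#t1, t2, t3#} + (A + B'))" using N AB s by (simp add: add_mset_commute)
    moreover have "tiles ({#t1, t2, t3#} + (A + B')) (Suc (Suc \<alpha>)) (Suc b')" using add_triangle[OF tiling_add[OF AB(2) s(5)] t] by simp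
    ultimately show "\<not> (adj x s1 \<and> adj x s2 \<and> adj x s3)" using no_complete_triangle s(2-4,6) R(2) by metis
  qed (use R in simp)
  then have "nb x {#t1, t2, t3#} \<ge> 2" using 1 R(2) by simp
  then show ?thesis using no_complete_triangle[OF N R t]
    by (cases "adj x t1"; cases "adj x t2"; cases "adj x t3"; simp)
qed

section \<open>The nonneighbours of the left-over vertex\<close>

text \<open>
  Every vertex of a 5-cycle formed by the left-over vertex and two edge tiles can be left over; a
  further tile then induces a proper 2-coloring of the odd cycle.
\<close>

lemma cycle5_edge:
  assumes N: "mset_set V = {#w0, w1, w2, w3, w4, p, q#} + R" and R: "tiles R a \<beta>" "\<alpha> = Suc a"
    and c: "adj w0 w1" "adj w1 w2" "adj w2 w3" "adj w3 w4" and pq: "adj p q"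
  shows "adj w0 p \<noteq> adj w0 q" "\<not> (adj w0 p \<and> adj w1 p)" "\<not> (adj w0 q \<and> adj w1 q)"
proof -
  show "adj w0 p \<noteq> adj w0 q"
    by (rule single_edge_exact[OF _ add_edge[OF add_edge[OF R(1) c(2)] c(4), folded R(2)] pq])
      (use N in \<open>simp add: add_mset_commute\<close>)
  have t: "tiles ({#w3, w4#} + R) \<alpha> \<beta>" using add_edge[OF R(1) c(4)] R(2) by simp
  have "mset_set V = {#p, w0, w1, q, w2#} + ({#w3, w4#} + R)" "mset_set V = {#q, w0, w1, p, w2#} + ({#w3, w4#} + R)"
    using N by (simp_all add: add_mset_commute)
  from no_triangle_among_five[OF this(1) t] no_triangle_among_five[OF this(2) t]
  show "\<not> (adj w0 p \<and> adj w1 p)" "\<not> (adj w0 q \<and> adj w1 q)" using c(1) adj_commute by blast+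
qed

text \<open>Colour a vertex of the cycle by its unique nonneighbour in the triangle. Disjoint edges
  of the cycle cannot have different common neighbours there, so consecutive colours differ and
  disjoint edges carry the same two colours.\<close>

lemma cycle5_triangle:
  assumes N: "mset_set V = {#w0, w1, w2, w3, w4, t1, t2, t3#} + R" and R: "tiles R \<alpha> b" "\<beta> = Suc b"
    and c: "adj w1 w2" "adj w3 w4" and t: "adj t1 t2" "adj t1 t3" "adj t2 t3"
  shows "nb w0 {#t1, t2, t3#} = 2"
    "\<not> (adj w1 t1 \<and> adj w2 t1 \<and> adj w3 t2 \<and> adj w4 t2)" "\<not> (adj w1 t1 \<and> adj w2 t1 \<and> adj w3 t3 \<and> adj w4 t3)"
    "\<not> (adj w1 t2 \<and> adj w2 t2 \<and> adj w3 t1 \<and> adj w4 t1)" "\<not> (adj w1 t2 \<and> adj w2 t2 \<and> adj w3 t3 \<and> adj w4 t3)"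
    "\<not> (adj w1 t3 \<and> adj w2 t3 \<and> adj w3 t1 \<and> adj w4 t1)" "\<not> (adj w1 t3 \<and> adj w2 t3 \<and> adj w3 t2 \<and> adj w4 t2)"
proof -
  show "nb w0 {#t1, t2, t3#} = 2"
    by (rule single_triangle_exact[OF _ add_edge[OF add_edge[OF R(1) c(1)] c(2)] R(2) t])
      (use N in \<open>simp add: add_mset_commute\<close>)
  have N': "mset_set V = {#w0, w1, w2, w3, w4, t1, t3, t2#} + R" "mset_set V = {#w0, w1, w2, w3, w4, t2, t1, t3#} + R"
    "mset_set V = {#w0, w1, w2, w3, w4, t2, t3, t1#} + R" "mset_set V = {#w0, w1, w2, w3, w4, t3, t1, t2#} + R"
    "mset_set V = {#w0, w1, w2, w3, w4, t3, t2, t1#} + R"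
    using N by (simp_all add: add_mset_commute)
  have t': "adj t2 t1" "adj t3 t1" "adj t3 t2" using t by (simp_all add: adj_commute)
  show "\<not> (adj w1 t1 \<and> adj w2 t1 \<and> adj w3 t2 \<and> adj w4 t2)" using two_edges_triangle(1)[OF N R c t(3)] .
  show "\<not> (adj w1 t1 \<and> adj w2 t1 \<and> adj w3 t3 \<and> adj w4 t3)" using two_edges_triangle(1)[OF N'(1) R c t'(3)] .
  show "\<not> (adj w1 t2 \<and> adj w2 t2 \<and> adj w3 t1 \<and> adj w4 t1)" using two_edges_triangle(1)[OF N'(2) R c t(2)] .
  show "\<not> (adj w1 t2 \<and> adj w2 t2 \<and> adj w3 t3 \<and> adj w4 t3)" using two_edges_triangle(1)[OF N'(3) R c t'(2)] .
  show "\<not> (adj w1 t3 \<and> adj w2 t3 \<and> adj w3 t1 \<and> adj w4 t1)" using two_edges_triangle(1)[OF N'(4) R c t(1)] .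
  show "\<not> (adj w1 t3 \<and> adj w2 t3 \<and> adj w3 t2 \<and> adj w4 t2)" using two_edges_triangle(1)[OF N'(5) R c t'(1)] .
qed

lemma no_cycle5:
  assumes N: "mset_set V = {#w0, w1, w2, w3, w4#} + R" and R: "tiles R \<alpha> \<beta>"
    and c: "adj w0 w1" "adj w1 w2" "adj w2 w3" "adj w3 w4" "adj w4 w0"
  shows False
proof (cases \<alpha>)
  case (Suc a)
  then obtain p q R' where pq: "R = {#p, q#} + R'" "adj p q" "tiles R' a \<beta>" using tiling_obtain_edge R by metis
  have "mset_set V = {#w0, w1, w2, w3, w4, p, q#} + R'" "mset_set V = {#w1, w2, w3, w4, w0, p, q#} + R'"
    "mset_set V = {#w2, w3, w4, w0, w1, p, q#} + R'" "mset_set V = {#w3, w4, w0, w1, w2, p, q#} + R'"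
    "mset_set V = {#w4, w0, w1, w2, w3, p, q#} + R'"
    using N pq by (simp_all add: add_mset_commute)
  note cycle5_edge[OF this(1) pq(3) Suc c(1-4) pq(2)] cycle5_edge[OF this(2) pq(3) Suc c(2-5) pq(2)]
    cycle5_edge[OF this(3) pq(3) Suc c(3-5,1) pq(2)] cycle5_edge[OF this(4) pq(3) Suc c(4-5,1,2) pq(2)]
    cycle5_edge[OF this(5) pq(3) Suc c(5,1-3) pq(2)]
  then show False by blast
next
  case 0
  \<comment> \<open>Without a spare edge tile, \<open>nontrivial\<close> provides a spare triangle
    tile.\<close>
  then obtain b where b: "\<beta> = Suc b" using nontrivial by (cases \<beta>) auto
  then obtain t1 t2 t3 R' where t: "R = {#t1, t2, t3#} + R'" "adj t1 t2" "adj t1 t3" "adj t2 t3" "tiles R' \<alpha> b"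
    using tiling_obtain_triangle R by metis
  have "mset_set V = {#w0, w1, w2, w3, w4, t1, t2, t3#} + R'" "mset_set V = {#w1, w2, w3, w4, w0, t1, t2, t3#} + R'"
    "mset_set V = {#w2, w3, w4, w0, w1, t1, t2, t3#} + R'" "mset_set V = {#w3, w4, w0, w1, w2, t1, t2, t3#} + R'"
    "mset_set V = {#w4, w0, w1, w2, w3, t1, t2, t3#} + R'"
    using N t by (simp_all add: add_mset_commute)
  note cy = cycle5_triangle[OF this(1) t(5) b c(2,4) t(2-4)] cycle5_triangle[OF this(2) t(5) b c(3,5) t(2-4)]
    cycle5_triangle[OF this(3) t(5) b c(4,1) t(2-4)] cycle5_triangle[OF this(4) t(5) b c(5,2) t(2-4)]
    cycle5_triangle[OF this(5) t(5) b c(1,3) t(2-4)]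
  have two: "\<not> adj w t1 \<and> adj w t2 \<and> adj w t3 \<or> adj w t1 \<and> \<not> adj w t2 \<and> adj w t3 \<or> adj w t1 \<and> adj w t2 \<and> \<not> adj w t3"
    if "nb w {#t1, t2, t3#} = 2" for w
    using that by (cases "adj w t1"; cases "adj w t2"; cases "adj w t3"; simp)
  show False
    using two[OF cy(1)] two[OF cy(8)] two[OF cy(15)] two[OF cy(22)] two[OF cy(29)]
      cy(2-7,9-14,16-21,23-28,30-35) by argo
qed

section \<open>Wheels with five spokes\<close>

text \<open>With the tiles \<open>h r1 r2\<close> and \<open>r3 r4\<close>, the rim vertex
  \<open>r0\<close> is left over; the triangles \<open>p r0 r1\<close> and \<open>h r2 r3\<close>
  would leave two vertices missed. So \<open>p\<close> and \<open>q\<close> induce a proper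
  2-coloring of the odd rim.\<close>

lemma wheel5_edge:
  assumes N: "mset_set V = {#h, r0, r1, r2, r3, r4, p, q#} + R" and R: "tiles R \<alpha> b" "\<beta> = Suc b"
    and c: "adj r0 r1" "adj r1 r2" "adj r2 r3" "adj r3 r4" and pq: "adj p q"
    and h: "adj h r1" "adj h r2" "adj h r3"
  shows "adj r0 p \<noteq> adj r0 q" "\<not> (adj r0 p \<and> adj r1 p)" "\<not> (adj r0 q \<and> adj r1 q)"
proof -
  show "adj r0 p \<noteq> adj r0 q"
    by (rule single_edge_exact[OF _ add_triangle[OF add_edge[OF R(1) c(4)] h(1,2) c(2), folded R(2)] pq])
      (use N in \<open>simp add: add_mset_commute\<close>)
  have "mset_set V = {#p, r0, r1, h, r2, r3, q, r4#} + R" "mset_set V = {#q, r0, r1, h, r2, r3, p, r4#} + R"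
    using N by (simp_all add: add_mset_commute)
  from no_two_triangles_among_eight[OF this(1) R] no_two_triangles_among_eight[OF this(2) R]
  show "\<not> (adj r0 p \<and> adj r1 p)" "\<not> (adj r0 q \<and> adj r1 q)" using c h adj_commute by blast+
qed

lemma no_wheel5:
  assumes N: "mset_set V = {#h, r0, r1, r2, r3, r4, p, q#} + R" and R: "tiles R \<alpha> b" "\<beta> = Suc b"
    and c: "adj r0 r1" "adj r1 r2" "adj r2 r3" "adj r3 r4" "adj r4 r0" and pq: "adj p q"
    and h: "adj h r0" "adj h r1" "adj h r2" "adj h r3" "adj h r4"
  shows False
proof -
  have "mset_set V = {#h, r1, r2, r3, r4, r0, p, q#} + R"
    "mset_set V = {#h, r2, r3, r4, r0, r1, p, q#} + R" "mset_set V = {#h, r3, r4, r0, r1, r2, p, q#} + R"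
    "mset_set V = {#h, r4, r0, r1, r2, r3, p, q#} + R"
    using N by (simp_all add: add_mset_commute)
  note wheel5_edge[OF N R c(1-4) pq h(2-4)] wheel5_edge[OF this(1) R c(2-5) pq h(3-5)]
    wheel5_edge[OF this(2) R c(3-5,1) pq h(4-5,1)] wheel5_edge[OF this(3) R c(4-5,1,2) pq h(5,1,2)]
    wheel5_edge[OF this(4) R c(5,1-3) pq h(1-3)]
  then show False by blast
qed

section \<open>Nonneighbours in different tiles\<close>

text \<open>\<open>t1\<close> turns out to be the hub of a wheel with rim \<open>x u v t t2\<close>.
  Its missing spoke to \<open>u\<close> comes from leaving \<open>u\<close> over, with tiles
  \<open>v t t1\<close> and \<open>x t2\<close>.\<close>

lemma nonneighbours_edge_triangle_aux:
  assumes N: "mset_set V = {#x, u, v, t, t1, t2#} + R" and R: "tiles R (Suc \<alpha>) b" "\<beta> = Suc b"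
    and uv: "adj u v" and t: "adj t t1" "adj t t2" "adj t1 t2"
    and x: "adj x u" "adj x t1" "adj x t2" and n: "\<not> adj t u" "adj v t" "adj v t1" "\<not> adj v t2"
  shows False
proof -
  obtain p q S where pq: "R = {#p, q#} + S" "adj p q" "tiles S \<alpha> b" using tiling_obtain_edge[OF R(1)] .
  have "\<not> adj u t2"
    by (rule notI, rule no_tiling[OF N add_triangle[OF add_triangle[OF R(1), of x t2 u], of v t t1]])
      (use x n t R in \<open>simp_all add: add_mset_commute adj_commute\<close>)
  moreover have "nb u {#v, t, t1#} = 2"
    by (rule single_triangle_exact[OF _ add_edge[OF add_edge[OF pq(3,2)] x(3)] R(2) n(2,3) t(1)])
      (use N pq in \<open>simp add: add_mset_commute\<close>)
  ultimately have ut: "adj u t1" using n uv by (cases "adj u t1") (simp_all add: adj_commute)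
  have "mset_set V = {#t1, x, u, v, t, t2, p, q#} + S" using N pq by (simp add: add_mset_commute)
  from no_wheel5[OF this pq(3) R(2) x(1) uv n(2) t(2) _ pq(2)] show False
    using x ut n t adj_commute by metis
qed

text \<open>With the tile \<open>x t1 t2\<close>, the vertex \<open>t\<close> is left over and sees
  exactly one of \<open>u\<close>, \<open>v\<close>. If it is \<open>v\<close>, then with the tile
  \<open>x u\<close> the vertex \<open>v\<close> is left over and sees exactly one of
  \<open>t1\<close>, \<open>t2\<close>, as in the auxiliary lemma.\<close>

lemma nonneighbours_edge_triangle:
  assumes N: "mset_set V = {#x, u, v, t, t1, t2#} + R" and R: "tiles R (Suc \<alpha>) b" "\<beta> = Suc b"
    and uv: "adj u v" and t: "adj t t1" "adj t t2" "adj t1 t2"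
    and x: "adj x u" "\<not> adj x t"
  shows "adj x t1" "adj x t2" "adj t u" "\<not> adj t v"
proof -
  obtain p q S where pq: "R = {#p, q#} + S" "adj p q" "tiles S \<alpha> b" using tiling_obtain_edge[OF R(1)] .
  have "nb x {#t, t1, t2#} = 2"
    by (rule single_triangle_exact[OF _ add_edge[OF R(1) uv] R(2) t])
      (use N pq in \<open>simp add: add_mset_commute\<close>)
  then show xt: "adj x t1" "adj x t2" using x by (cases "adj x t1"; cases "adj x t2"; simp)+
  have ex: "adj t u \<noteq> adj t v"
    by (rule single_edge_exact[OF _ add_triangle[OF R(1) xt t(3), folded R(2)] uv])
      (use N pq in \<open>simp add: add_mset_commute\<close>)
  have nv: "nb v {#t, t1, t2#} = 2"
    by (rule single_triangle_exact[OF _ add_edge[OF R(1) x(1)] R(2) t])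
      (use N pq in \<open>simp add: add_mset_commute\<close>)
  show "adj t u"
  proof (rule ccontr)
    assume n: "\<not> adj t u"
    then have vt: "adj v t" using ex adj_commute by blast
    have N': "mset_set V = {#x, u, v, t, t2, t1#} + R" using N by (simp add: add_mset_commute)
    have t': "adj t2 t1" using t(3) by (simp add: adj_commute)
    from nv vt have "adj v t1 \<and> \<not> adj v t2 \<or> adj v t2 \<and> \<not> adj v t1"
      by (cases "adj v t1"; cases "adj v t2"; simp)
    then show False
      using nonneighbours_edge_triangle_aux[OF N R uv t x(1) xt n vt]
        nonneighbours_edge_triangle_aux[OF N' R uv t(2,1) t' x(1) xt(2,1) n vt] by blast
  qed
  with ex show "\<not> adj t v" by blast
qed

text \<open>If \<open>t\<close> and \<open>s\<close> were adjacent, then for an edge tile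
  \<open>u v\<close> with \<open>u\<close> adjacent to \<open>x\<close> the triangles
  \<open>t s u\<close>, \<open>x t1 t2\<close> and \<open>v s1 s2\<close> would complete a
  tiling.\<close>

lemma nonneighbours_triangles:
  assumes N: "mset_set V = {#x, t, t1, t2, s, s1, s2#} + R" and R: "tiles R (Suc (Suc \<alpha>)) b" "\<beta> = Suc (Suc b)"
    and t: "adj t t1" "adj t t2" "adj t1 t2" and s: "adj s s1" "adj s s2" "adj s1 s2"
    and x: "\<not> adj x t" "\<not> adj x s"
  shows "\<not> adj t s"
proof
  assume ts: "adj t s"
  obtain p q S where pq: "R = {#p, q#} + S" "adj p q" "tiles S (Suc \<alpha>) b" using tiling_obtain_edge[OF R(1)] .
  have "mset_set V = {#x, p, q#} + ({#t, t1, t2#} + ({#s, s1, s2#} + S))"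
    using N pq by (simp add: add_mset_commute)
  from single_edge_exact[OF this add_triangle[OF add_triangle[OF pq(3) s] t, folded R(2)] pq(2)]
  obtain u v where uv: "R = {#u, v#} + S" "adj u v" "adj x u"
    using pq adj_commute by (metis add_mset_commute add_mset_add_single union_mset_add_mset_left add_0)
  have Nt: "mset_set V = {#x, u, v, t, t1, t2#} + ({#s, s1, s2#} + S)"
    and Ns: "mset_set V = {#x, u, v, s, s1, s2#} + ({#t, t1, t2#} + S)"
    using N uv by (simp_all add: add_mset_commute)
  note nt = nonneighbours_edge_triangle[OF Nt add_triangle[OF pq(3) s] R(2) uv(2) t uv(3) x(1)]
  note ns = nonneighbours_edge_triangle[OF Ns add_triangle[OF pq(3) t] R(2) uv(2) s uv(3) x(2)]
  have "nb v {#s, s1, s2#} = 2"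
    by (rule single_triangle_exact[OF _ add_edge[OF add_triangle[OF pq(3) t] uv(3)] R(2) s])
      (use N uv in \<open>simp add: add_mset_commute\<close>)
  then have "adj v s1" "adj v s2" using ns(4)
    by (cases "adj v s1"; cases "adj v s2"; simp add: adj_commute)+
  then show False
    by (intro no_tiling[OF Nt add_triangle[OF add_triangle[OF add_triangle[OF pq(3), of t s u], of x t1 t2], of v s1 s2]])
      (use nt ns ts s t R(2) in \<open>simp_all add: add_mset_commute adj_commute\<close>)
qed

text \<open>Two adjacent nonneighbours of \<open>x\<close> exist by the exact degree and lie in
  different tiles, as each tile contains just one. Two edge tiles give a 5-cycle through
  \<open>x\<close>; the preceding lemmas treat the other cases.\<close>

lemma no_single:
  assumes N: "mset_set V = add_mset x R" and R: "tiles R (Suc (Suc \<alpha>)) \<beta>"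
  shows False
proof -
  have V: "v \<in> V \<longleftrightarrow> v = x \<or> v \<in># R" for v
    using N finite_V by (metis elem_mset_set insert_iff set_mset_add_mset_insert)
  obtain A B where AB: "R = A + B" "tiles A (Suc (Suc \<alpha>)) 0" "tiles B 0 \<beta>" using tiling_split[OF R] .
  obtain y z where yz: "y \<in> V" "z \<in> V" "\<not> adj x y" "\<not> adj x z" "y \<noteq> z" "adj y z"
    using nonneighbours_not_independent[of x] single_nb_exact(3)[OF N[unfolded AB(1)] AB(2,3)] V by metis
  \<comment> \<open>Stated for arbitrary \<open>y\<close> and \<open>z\<close>, since either of the
    two nonneighbours may be the one in the edge tile.\<close>
  have mixed: False if "R = {#y, u#} + R'" "adj y u" "Suc (Suc \<alpha>) = Suc a" "tiles R' a \<beta>"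
    "R' = {#z, t1, t2#} + S" "adj z t1" "adj z t2" "adj t1 t2" "\<beta> = Suc b" "tiles S a b"
    "adj y z" "\<not> adj x y" "\<not> adj x z" for y z u R' t1 t2 a b S
  proof -
    have "adj x y \<noteq> adj x u"
      by (rule single_edge_exact[OF _ _ that(2)]) (use N that in simp_all)
    moreover have "mset_set V = {#x, u, y, z, t1, t2#} + S" using N that by (simp add: add_mset_commute)
    ultimately show False using nonneighbours_edge_triangle(4)[of x u y z t1 t2 S b] that adj_commute by simp
  qed
  have "y \<in># R" "z \<in># R" using V yz adj_commute by metis+
  from sym R this(1) show False
  proof (cases rule: tiling_mem)
    case y: (edge u R' a)
    have xu: "adj x u"
      using single_edge_exact[of x y u R'] N y yz(3) by simp
    then have "z \<in># R'" using \<open>z \<in># R\<close> y(1) yz by auto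
    with sym y(4) show False
    proof (cases rule: tiling_mem)
      case z: (edge w S c)
      have "adj x w" using single_edge_exact[of x z w "{#y, u#} + S"] add_edge[OF z(4) y(2)] N y z yz(4) by (simp add: add_mset_commute)
      moreover have "mset_set V = {#x, u, y, z, w#} + S" using N y z by (simp add: add_mset_commute)
      ultimately show False using no_cycle5[of x u y z w S] xu y z yz adj_commute by simp
    next
      case (triangle t1 t2 S b)
      then show False using mixed[OF y] yz by blast
    qed
  next
    case y: (triangle t1 t2 R' b)
    have "nb x {#y, t1, t2#} = 2" using single_triangle_exact[of x y t1 t2 R' b] N y by simp
    then have "adj x t1" "adj x t2" using yz(3) by (cases "adj x t1"; cases "adj x t2"; simp)+
    then have "z \<in># R'" using \<open>z \<in># R\<close> y(1) yz by auto
    with sym y(6) show False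
    proof (cases rule: tiling_mem)
      case z: (edge w S c)
      have "R = {#z, w#} + ({#y, t1, t2#} + S)" using y z by (simp add: add_mset_commute)
      from mixed[OF this z(2,3) _ refl y(2-5) _ _ yz(4,3)] show False
        using add_triangle[OF z(4) y(2-4)] y(5) z(4) yz(6) adj_commute by simp
    next
      case z: (triangle s1 s2 S c)
      have "mset_set V = {#x, y, t1, t2, z, s1, s2#} + S" using N y z by (simp add: add_mset_commute)
      from nonneighbours_triangles[OF this z(6) _ y(2-4) z(2-4) yz(3,4)] show False
        using y(5) z(5) yz(6) by simp
    qed
  qed
qed

end

section \<open>Existence of tilings\<close>

text \<open>Ensures that an untileable graph has a missing edge that can be added.\<close>

lemma tiling_complete:
  assumes "finite S" "card S = 2 * a + 3 * b" "\<And>u v. u \<in> S \<Longrightarrow> v \<in> S \<Longrightarrow> u \<noteq> v \<Longrightarrow> adj u v"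
  shows "tiling adj (mset_set S) a b"
  using assms
proof (induction a arbitrary: S)
  case 0
  then show ?case
  proof (induction b arbitrary: S)
    case 0
    then show ?case by (simp add: tiling.empty)
  next
    case (Suc b)
    have "3 \<le> card S" using Suc.prems by simp
    then obtain U where "U \<subseteq> S" "card U = 3" by (metis obtain_subset_with_card_n)
    then obtain u v w where uvw: "u \<in> S" "v \<in> S" "w \<in> S" "u \<noteq> v" "u \<noteq> w" "v \<noteq> w"
      by (auto simp: card_3_iff)
    define D where "D = S - {u, v, w}"
    have D: "S = insert u (insert v (insert w D))" "u \<notin> D" "v \<notin> D" "w \<notin> D" "finite D"
      using uvw Suc.prems(1) by (auto simp: D_def)
    have "mset_set S = {#u, v, w#} + mset_set D" unfolding D(1) using D(2-5) uvw by simp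
    moreover have "tiling adj (mset_set D) 0 b"
      using D uvw Suc.prems by (intro Suc.IH) auto
    ultimately show ?case using tiling.triangle[of adj "mset_set D" 0 b u v w] uvw Suc.prems by simp
  qed
next
  case (Suc a)
  have "2 \<le> card S" using Suc.prems by simp
  then obtain U where "U \<subseteq> S" "card U = 2" by (metis obtain_subset_with_card_n)
  then obtain u v where uv: "u \<in> S" "v \<in> S" "u \<noteq> v" by (auto simp: card_2_iff)
  define D where "D = S - {u, v}"
  have D: "S = insert u (insert v D)" "u \<notin> D" "v \<notin> D" "finite D"
    using uv Suc.prems(1) by (auto simp: D_def)
  have "mset_set S = {#u, v#} + mset_set D" unfolding D(1) using D(2-4) uv by simp
  moreover have "tiling adj (mset_set D) a b"
    using D uv Suc.prems by (intro Suc.IH) auto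
  ultimately show ?case using tiling.edge[of adj "mset_set D" a b u v] uv Suc.prems by simp
qed

text \<open>Multiplicities at most one mean that at most one tile uses the added edge
  \<open>x y\<close>. Such a tile is split off; from a triangle the old edge \<open>y z\<close>
  survives.\<close>

lemma tiling_remove_edge:
  assumes "tiling adj' M a b" and "symp adj" and "x \<noteq> y" "\<And>v. count M v \<le> 1"
    and "\<And>u v. adj' u v \<Longrightarrow> adj u v \<or> {u, v} = {x, y}"
  obtains "tiling adj M a b"
  | R a' where "M = {#x, y#} + R" "a = Suc a'" "tiling adj R a' b"
  | z R b' where "M = {#x, y, z#} + R" "b = Suc b'" "adj y z" "tiling adj R a b'"
proof -
  have off: "adj u v" if "adj' u v" "u \<noteq> x" "v \<noteq> x" for u v
    using assms(5)[OF that(1)] that(2,3) by (auto simp: doubleton_eq_iff)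
  have "tiling adj M a b \<or> (\<exists>R a'. M = {#x, y#} + R \<and> a = Suc a' \<and> tiling adj R a' b) \<or>
    (\<exists>z R b'. M = {#x, y, z#} + R \<and> b = Suc b' \<and> adj y z \<and> tiling adj R a b')"
    (is "?P M a b")
    using assms(1,4)
  proof induction
    case empty
    then show ?case using tiling.empty by blast
  next
    case (edge M a b u v)
    have "count M w \<le> 1" for w using edge.prems[of w] by (simp split: if_splits)
    then consider (1) "tiling adj M a b" |
      (2) R a' where "M = {#x, y#} + R" "a = Suc a'" "tiling adj R a' b" |
      (3) z R b' where "M = {#x, y, z#} + R" "b = Suc b'" "adj y z" "tiling adj R a b'"
      using edge.IH by blast
    then show ?case
    proof cases
      case 1
      show ?thesis
      proof (cases "adj u v")
        case True
        then show ?thesis using tiling.edge[OF 1] by blast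
      next
        case False
        then have "{u, v} = {x, y}" using assms(5) edge.hyps(2) by blast
        then have "{#u, v#} + M = {#x, y#} + M" by (auto simp: doubleton_eq_iff add_mset_commute)
        then show ?thesis using 1 by blast
      qed
    next
      case 2
      have "0 < count M x" using 2(1) by simp
      \<comment> \<open>\<open>x\<close> already lies in the split-off tile, so the present tile
        avoids it and consists of old edges.\<close>
      then have "u \<noteq> x \<and> v \<noteq> x" using edge.prems[of x] by (auto simp: count_eq_zero_iff split: if_splits)
      then have "adj u v" using off edge.hyps(2) by blast
      then show ?thesis using tiling.edge[OF 2(3)] 2
        by (intro disjI2 disjI1 exI[of _ "{#u, v#} + R"]) (simp add: add_mset_commute)
    next
      case 3
      have "0 < count M x" using 3(1) by simp
      then have "u \<noteq> x \<and> v \<noteq> x" using edge.prems[of x] by (auto simp: count_eq_zero_iff split: if_splits)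
      then have "adj u v" using off edge.hyps(2) by blast
      then show ?thesis using tiling.edge[OF 3(4)] 3
        by (intro disjI2 exI[of _ z] exI[of _ "{#u, v#} + R"]) (simp add: add_mset_commute)
    qed
  next
    case (triangle M a b u v w)
    have "count M w \<le> 1" for w using triangle.prems[of w] by (simp split: if_splits)
    then consider (1) "tiling adj M a b" |
      (2) R a' where "M = {#x, y#} + R" "a = Suc a'" "tiling adj R a' b" |
      (3) z R b' where "M = {#x, y, z#} + R" "b = Suc b'" "adj y z" "tiling adj R a b'"
      using triangle.IH by blast
    then show ?case
    proof cases
      case 1
      have neq: "u \<noteq> v" "u \<noteq> w" "v \<noteq> w"
        using triangle.prems[of u] triangle.prems[of v] by (auto split: if_splits)
      \<comment> \<open>\<open>p q\<close> is the added side of the triangle, in any of the three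
        positions, and \<open>r\<close> the third vertex.\<close>
      have "?thesis" if "{#u, v, w#} = {#p, q, r#}" "{p, q} = {x, y}" "adj' p r \<or> adj' r p" "adj' q r \<or> adj' r q"
        "r \<noteq> p" "r \<noteq> q" for p q r
      proof -
        have r: "r \<noteq> x" "r \<noteq> y" using that(2,5,6) by (auto simp: doubleton_eq_iff)
        have "adj' y r \<or> adj' r y" using that(2-4) by (auto simp: doubleton_eq_iff)
        then have "adj y r" using assms(5)[of y r] assms(5)[of r y] r sympD[OF assms(2)] by (auto simp: doubleton_eq_iff)
        moreover have "{#u, v, w#} + M = {#x, y, r#} + M"
          unfolding that(1) using that(2) by (auto simp: doubleton_eq_iff add_mset_commute)
        ultimately show ?thesis using 1 by blast
      qed note * = this
      show ?thesis
      proof (cases "adj u v \<and> adj u w \<and> adj v w")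
        case True
        then show ?thesis using tiling.triangle[OF 1] by blast
      next
        case False
        then consider "{u, v} = {x, y}" | "{u, w} = {x, y}" | "{v, w} = {x, y}" using assms(5) triangle.hyps by blast
        then show ?thesis
          using *[of u v w] *[of u w v] *[of v w u] triangle.hyps(2-4) neq
          by cases (simp_all add: add_mset_commute)
      qed
    next
      case 2
      have "0 < count M x" using 2(1) by simp
      then have "u \<noteq> x \<and> v \<noteq> x \<and> w \<noteq> x" using triangle.prems[of x] by (auto simp: count_eq_zero_iff split: if_splits)
      then have "adj u v" "adj u w" "adj v w" using off triangle.hyps(2-4) by blast+
      then show ?thesis using tiling.triangle[OF 2(3)] 2
        by (intro disjI2 disjI1 exI[of _ "{#u, v, w#} + R"]) (simp add: add_mset_commute)
    next
      case 3
      have "0 < count M x" using 3(1) by simp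
      then have "u \<noteq> x \<and> v \<noteq> x \<and> w \<noteq> x" using triangle.prems[of x] by (auto simp: count_eq_zero_iff split: if_splits)
      then have "adj u v" "adj u w" "adj v w" using off triangle.hyps(2-4) by blast+
      then show ?thesis using tiling.triangle[OF 3(4)] 3
        by (intro disjI2 exI[of _ z] exI[of _ "{#u, v, w#} + R"]) (simp add: add_mset_commute)
    qed
  qed
  then show thesis using that by blast
qed

lemma nbrs_in_mono: "(\<And>u. adj x u \<Longrightarrow> adj' x u) \<Longrightarrow> nbrs_in adj x M \<le> nbrs_in adj' x M"
  by (induction M) (auto simp: add_mono)

text \<open>Induction on the number of ordered nonadjacent pairs. The hypotheses survive the
  addition of an edge, and removing it again from a tiling leads to \<open>no_two_singles\<close> or
  \<open>no_single\<close>.\<close>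

lemma tiling_exists:
  assumes "symp adj" "\<And>x. \<not> adj x x" "finite V" "card V = 2 * \<alpha> + 3 * \<beta> + 5" "1 \<le> \<alpha> + \<beta>"
    and "\<And>x. x \<in> V \<Longrightarrow> \<alpha> + 2 * \<beta> + 2 \<le> nbrs_in adj x (mset_set V)"
    and "\<And>I. I \<subseteq> V \<Longrightarrow> card I = \<alpha> + \<beta> + 3 \<Longrightarrow> \<exists>x\<in>I. \<exists>y\<in>I. x \<noteq> y \<and> adj x y"
  shows "tiling adj (mset_set V) (Suc \<alpha>) (Suc \<beta>)"
  using assms(1,2,6,7)
proof (induction "card {(x, y). x \<in> V \<and> y \<in> V \<and> x \<noteq> y \<and> \<not> adj x y}" arbitrary: adj rule: less_induct)
  case less
  show ?case
  proof (rule ccontr)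
    assume nt: "\<not> ?thesis"
    then interpret untileable adj V \<alpha> \<beta>
      using less.prems assms(3-5) by unfold_locales blast+
    obtain x y where xy: "x \<in> V" "y \<in> V" "x \<noteq> y" "\<not> adj x y"
      using tiling_complete[of V "Suc \<alpha>" "Suc \<beta>" adj] nt assms(3,4) by fastforce
    define adj' where "adj' = (\<lambda>u v. adj u v \<or> u = x \<and> v = y \<or> u = y \<and> v = x)"
    have "{(x, y). x \<in> V \<and> y \<in> V \<and> x \<noteq> y \<and> \<not> adj' x y} \<subset> {(x, y). x \<in> V \<and> y \<in> V \<and> x \<noteq> y \<and> \<not> adj x y}"
      using xy unfolding adj'_def by blast
    moreover have "finite {(x, y). x \<in> V \<and> y \<in> V \<and> x \<noteq> y \<and> \<not> adj x y}"
      by (rule finite_subset[of _ "V \<times> V"]) (use finite_V in auto)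
    ultimately have "card {(x, y). x \<in> V \<and> y \<in> V \<and> x \<noteq> y \<and> \<not> adj' x y} < card {(x, y). x \<in> V \<and> y \<in> V \<and> x \<noteq> y \<and> \<not> adj x y}"
      by (rule psubset_card_mono[rotated])
    moreover have "symp adj'" using sym unfolding adj'_def symp_def by blast
    moreover have "\<not> adj' z z" for z using irrefl xy unfolding adj'_def by blast
    moreover have "\<alpha> + 2 * \<beta> + 2 \<le> nbrs_in adj' z (mset_set V)" if "z \<in> V" for z
      using degree[OF that] nbrs_in_mono[of adj z adj' "mset_set V"] unfolding adj'_def by simp
    moreover have "\<exists>x\<in>I. \<exists>y\<in>I. x \<noteq> y \<and> adj' x y" if "I \<subseteq> V" "card I = \<alpha> + \<beta> + 3" for I
      using independent[OF that] unfolding adj'_def by blast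
    ultimately have "tiling adj' (mset_set V) (Suc \<alpha>) (Suc \<beta>)" using less.hyps by blast
    then show False
    proof (rule tiling_remove_edge)
      show "symp adj" "x \<noteq> y" using sym xy by blast+
      show "count (mset_set V) v \<le> 1" for v by (cases "v \<in> V"; cases "finite V"; simp)
      show "adj u v \<or> {u, v} = {x, y}" if "adj' u v" for u v using that unfolding adj'_def by auto
      show False if "tiling adj (mset_set V) (Suc \<alpha>) (Suc \<beta>)" using nt that by blast
      show False if "mset_set V = {#x, y#} + R" "Suc \<alpha> = Suc a" "tiling adj R a (Suc \<beta>)" for R a
        using no_two_singles[OF that(1)] that by simp
    next
      fix z R b assume 3: "mset_set V = {#x, y, z#} + R" "Suc \<beta> = Suc b" "adj y z" "tiling adj R (Suc \<alpha>) b"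
      \<comment> \<open>With \<open>y z\<close> as an edge tile there are \<alpha> + 2 edges and
        \<beta> triangles, and \<open>x\<close> is left over.\<close>
      have "mset_set V = add_mset x ({#y, z#} + R)" using 3 by simp
      moreover have "tiling adj ({#y, z#} + R) (Suc (Suc \<alpha>)) \<beta>" using tiling.edge[OF 3(4,3)] 3(2) by simp
      ultimately show False using no_single by blast
    qed
  qed
qed

section \<open>Equitable colorings\<close>

text \<open>Each tile becomes a color class. It will be applied with \<open>adj\<close> as
  nonadjacency in the graph to be colored.\<close>

lemma tiling_colouring:
  assumes "tiling adj M a b" "symp adj" "\<And>v. count M v \<le> 1"
  obtains \<pi> where "\<pi> ` set_mset M \<subseteq> {1..a + b}"
    "\<And>u v. u \<in># M \<Longrightarrow> v \<in># M \<Longrightarrow> u \<noteq> v \<Longrightarrow> \<pi> u = \<pi> v \<Longrightarrow> adj u v"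
    "\<And>i. i \<in> {1..a + b} \<Longrightarrow> card {v \<in> set_mset M. \<pi> v = i} \<in> {2, 3}"
proof -
  have step: "\<exists>\<pi>. \<pi> ` (S \<union> C) \<subseteq> {1..Suc n} \<and>
      (\<forall>u\<in>S \<union> C. \<forall>v\<in>S \<union> C. u \<noteq> v \<longrightarrow> \<pi> u = \<pi> v \<longrightarrow> adj u v) \<and>
      (\<forall>i\<in>{1..Suc n}. card {v \<in> S \<union> C. \<pi> v = i} \<in> {2, 3})"
    if \<pi>: "\<pi> ` S \<subseteq> {1..n}" "\<forall>u\<in>S. \<forall>v\<in>S. u \<noteq> v \<longrightarrow> \<pi> u = \<pi> v \<longrightarrow> adj u v"
      "\<forall>i\<in>{1..n}. card {v \<in> S. \<pi> v = i} \<in> {2, 3}"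
      and C: "S \<inter> C = {}" "card C \<in> {2, 3}" "\<forall>u\<in>C. \<forall>v\<in>C. u \<noteq> v \<longrightarrow> adj u v"
    for S C :: "'a set" and \<pi> n
  proof (intro exI[of _ "\<lambda>v. if v \<in> C then Suc n else \<pi> v"] conjI ballI)
    let ?\<pi> = "\<lambda>v. if v \<in> C then Suc n else \<pi> v"
    show "?\<pi> ` (S \<union> C) \<subseteq> {1..Suc n}" using \<pi>(1) by auto
    show "u \<noteq> v \<longrightarrow> ?\<pi> u = ?\<pi> v \<longrightarrow> adj u v" if "u \<in> S \<union> C" "v \<in> S \<union> C" for u v
      using that \<pi>(1,2) C(3) by (auto simp: image_subset_iff)
    show "card {v \<in> S \<union> C. ?\<pi> v = i} \<in> {2, 3}" if i: "i \<in> {1..Suc n}" for i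
    proof (cases "i = Suc n")
      case True
      have "{v \<in> S \<union> C. ?\<pi> v = i} = C" using \<pi>(1) True by (auto simp: image_subset_iff)
      then show ?thesis using C(2) by simp
    next
      case False
      have "{v \<in> S \<union> C. ?\<pi> v = i} = {v \<in> S. \<pi> v = i}" using C(1) False by auto
      then show ?thesis using \<pi>(3) False i by simp
    qed
  qed
  have "\<exists>\<pi>. \<pi> ` set_mset M \<subseteq> {1..a + b} \<and>
      (\<forall>u\<in>set_mset M. \<forall>v\<in>set_mset M. u \<noteq> v \<longrightarrow> \<pi> u = \<pi> v \<longrightarrow> adj u v) \<and>
      (\<forall>i\<in>{1..a + b}. card {v \<in> set_mset M. \<pi> v = i} \<in> {2, 3})"
    using assms(1,3)
  proof induction
    case empty
    then show ?case by simp
  next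
    case (edge M a b u v)
    have "count M w \<le> 1" for w using edge.prems[of w] by (simp split: if_splits)
    from edge.IH[OF this] obtain \<pi> where \<pi>: "\<pi> ` set_mset M \<subseteq> {1..a + b}"
      "\<forall>u\<in>set_mset M. \<forall>v\<in>set_mset M. u \<noteq> v \<longrightarrow> \<pi> u = \<pi> v \<longrightarrow> adj u v"
      "\<forall>i\<in>{1..a + b}. card {v \<in> set_mset M. \<pi> v = i} \<in> {2, 3}" by blast
    have "u \<noteq> v" "u \<notin># M" "v \<notin># M"
      using edge.prems[of u] edge.prems[of v] by (auto simp: not_in_iff split: if_splits)
    then have "set_mset M \<inter> {u, v} = {}" "card {u, v} \<in> {2, 3}" by auto
    moreover have "\<forall>x\<in>{u, v}. \<forall>y\<in>{u, v}. x \<noteq> y \<longrightarrow> adj x y" using edge.hyps assms(2) by (auto dest: sympD)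
    ultimately show ?case using step[OF \<pi>, of "{u, v}"] by (simp add: insert_commute)
  next
    case (triangle M a b u v w)
    have "count M w \<le> 1" for w using triangle.prems[of w] by (simp split: if_splits)
    from triangle.IH[OF this] obtain \<pi> where \<pi>: "\<pi> ` set_mset M \<subseteq> {1..a + b}"
      "\<forall>u\<in>set_mset M. \<forall>v\<in>set_mset M. u \<noteq> v \<longrightarrow> \<pi> u = \<pi> v \<longrightarrow> adj u v"
      "\<forall>i\<in>{1..a + b}. card {v \<in> set_mset M. \<pi> v = i} \<in> {2, 3}" by blast
    have "u \<noteq> v" "u \<noteq> w" "v \<noteq> w" "u \<notin># M" "v \<notin># M" "w \<notin># M"
      using triangle.prems[of u] triangle.prems[of v] triangle.prems[of w] by (auto simp: not_in_iff split: if_splits)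
    then have "set_mset M \<inter> {u, v, w} = {}" "card {u, v, w} \<in> {2, 3}" by auto
    moreover have "\<forall>x\<in>{u, v, w}. \<forall>y\<in>{u, v, w}. x \<noteq> y \<longrightarrow> adj x y" using triangle.hyps assms(2) by (auto dest: sympD)
    ultimately show ?case using step[OF \<pi>, of "{u, v, w}"] by (simp add: insert_commute)
  qed
  then show thesis using that by blast
qed

text \<open>Every vertex of \<open>I\<close> has its full number \<Delta> of neighbours inside
  \<open>I\<close>, so no arc leaves \<open>I\<close> and no larger subgraph containing it is
  connected.\<close>

lemma clique_component:
  assumes "graph G" and I: "I \<subseteq> verts G" "card I = max_degree G + 1"
    and adj: "\<And>u v. u \<in> I \<Longrightarrow> v \<in> I \<Longrightarrow> u \<noteq> v \<Longrightarrow> u \<rightarrow>\<^bsub>G\<^esub> v"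
  shows "is_component (G \<restriction> I) G \<and> complete_digraph (max_degree G + 1) (G \<restriction> I)"
proof
  interpret graph G by fact
  have ind: "induced_subgraph (G \<restriction> I) G" using I(1) by blast
  interpret H: digraph "G \<restriction> I" using digraphI_induced[OF ind] .
  interpret Hs: sym_digraph "G \<restriction> I" using induced_graph_imp_graph[OF ind] .
  have H: "graph (G \<restriction> I)" by unfold_locales
  have ends: "u \<rightarrow>\<^bsub>G \<restriction> I\<^esub> v \<longleftrightarrow> u \<in> I \<and> v \<in> I \<and> u \<noteq> v" for u v
    using adj[of u v] no_loops by (auto simp: arcs_ends_conv)
  show "complete_digraph (max_degree G + 1) (G \<restriction> I)"
    unfolding complete_digraph_def using H I(2) ends by auto
  have closed: "v \<in> I" if "u \<in> I" "u \<rightarrow>\<^bsub>G\<^esub> v" for u v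
  proof -
    have "finite I" using I(1) finite_verts finite_subset by blast
    have fin: "finite {w. u \<rightarrow>\<^bsub>G\<^esub> w}"
      by (rule finite_subset[of _ "verts G"]) (auto simp: adj_in_verts)
    have "card {w. u \<rightarrow>\<^bsub>G\<^esub> w} \<le> max_degree G"
      unfolding max_degree_def out_degree_eq_card_neighbours[symmetric] using that I(1) by (intro Max_ge) auto
    moreover have "I - {u} \<subseteq> {w. u \<rightarrow>\<^bsub>G\<^esub> w}" using adj that by blast
    moreover have "card (I - {u}) = max_degree G" using I(2) that \<open>finite I\<close> by simp
    ultimately have "I - {u} = {w. u \<rightarrow>\<^bsub>G\<^esub> w}" using fin by (metis card_seteq)
    then show ?thesis using that by blast
  qed
  have "strongly_connected (G \<restriction> I)"
  proof (rule strongly_connectedI)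
    show "verts (G \<restriction> I) \<noteq> {}" using I(2) by auto
    show "u \<rightarrow>\<^sup>*\<^bsub>G \<restriction> I\<^esub> v" if "u \<in> verts (G \<restriction> I)" "v \<in> verts (G \<restriction> I)" for u v
      using that ends[of u v] by (cases "u = v") auto
  qed
  then have conn: "connected (G \<restriction> I)"
    unfolding connected_def strongly_connected_def using H.reachable_mk_symmetricI by auto
  show "is_component (G \<restriction> I) G"
    unfolding is_component_def
  proof (rule max_subgraphI)
    show "connected (G \<restriction> I)" by fact
    show "subgraph (G \<restriction> I) G" using ind by blast
    fix H' assume H': "G \<restriction> I \<noteq> H'" "subgraph (G \<restriction> I) H'" "subgraph H' G"
    show "\<not> connected H'"
    proof
      assume con: "connected H'"
      \<comment> \<open>Connectedness refers to the symmetric closure; as \<open>G\<close> is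
        symmetric, a path in the closure of \<open>H'\<close> yields a path in \<open>G\<close>,
        which cannot leave \<open>I\<close>.\<close>
      have "verts H' \<subseteq> I"
      proof
        fix v assume v: "v \<in> verts H'"
        obtain u where u: "u \<in> I" using I(2) by fastforce
        then have "u \<in> verts H'" using H'(2) by (auto simp: subgraph_def)
        then have "u \<rightarrow>\<^sup>*\<^bsub>mk_symmetric H'\<^esub> v" using con v by (auto simp: connected_def strongly_connected_def)
        then have "u \<rightarrow>\<^sup>*\<^bsub>mk_symmetric G\<^esub> v" using subgraph_mk_symmetric[OF H'(3)] pre_digraph.reachable_mono by metis
        then have "u \<rightarrow>\<^sup>*\<^bsub>G\<^esub> v" using reachable_mk_symmetric_eq[OF sym_arcs] by simp
        then show "v \<in> I"
          by (induction rule: reachable_induct) (use u closed in auto)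
      qed
      then have "verts H' = I" using H'(2) by (auto simp: subgraph_def)
      moreover have "arcs H' = arcs (G \<restriction> I)"
        using H'(2,3) \<open>verts H' \<subseteq> I\<close> wf_digraph.tail_in_verts[of H'] wf_digraph.head_in_verts[of H']
        by (fastforce simp: subgraph_def compatible_def)
      moreover have "tail H' = tail G" "head H' = head G" using H'(3) by (auto simp: subgraph_def compatible_def)
      ultimately have "G \<restriction> I = H'" by (simp add: induce_subgraph_def)
      with H'(1) show False ..
    qed
  qed
qed

theorem theorem4:
  fixes G :: "('a, 'b) pre_digraph"
  assumes "graph G"
    and "card (verts G) \<ge> 6"
    and "(real (card (verts G)) + 1) / 3 \<le> real (max_degree G)"
    and "real (max_degree G) < real (card (verts G)) / 2"
    and "\<not> (\<exists>H. is_component H G \<and> complete_digraph (max_degree G + 1) H)"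
  shows "equitably_colorable G (max_degree G)"
proof -
  interpret graph G by fact
  let ?n = "card (verts G)" and ?k = "max_degree G"
  \<comment> \<open>Solving 2a + 3b = |G| and a + b = k gives a = 3k - |G| and b = |G| - 2k, here
    lowered by one. The bounds on k make the truncated subtractions exact, and |G| \<ge> 6 gives 1
    \<le> \<alpha> + \<beta>.\<close>
  define \<alpha> \<beta> where "\<alpha> = 3 * ?k - ?n - 1" and "\<beta> = ?n - 2 * ?k - 1"
  have "real (?n + 1) \<le> real (3 * ?k)" "real (2 * ?k) < real ?n" using assms(3,4) by simp_all
  then have "?n + 1 \<le> 3 * ?k" "2 * ?k < ?n" by (simp_all only: of_nat_le_iff of_nat_less_iff)
  then have n: "?n = 2 * \<alpha> + 3 * \<beta> + 5" and k: "?k = Suc \<alpha> + Suc \<beta>" and pos: "1 \<le> \<alpha> + \<beta>"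
    using assms(2) unfolding \<alpha>_def \<beta>_def by linarith+
  define adj where "adj = (\<lambda>u v. u \<noteq> v \<and> \<not> u \<rightarrow>\<^bsub>G\<^esub> v)"
  have sym: "symp adj" unfolding adj_def symp_def using graph_symmetric by blast
  have tiling: "tiling adj (mset_set (verts G)) (Suc \<alpha>) (Suc \<beta>)"
  proof (rule tiling_exists[OF sym _ finite_verts n pos])
    show "\<not> adj x x" for x by (simp add: adj_def)
    show "\<alpha> + 2 * \<beta> + 2 \<le> nbrs_in adj x (mset_set (verts G))" if "x \<in> verts G" for x
    proof -
      let ?N = "{w. x \<rightarrow>\<^bsub>G\<^esub> w}"
      have N: "?N \<subseteq> verts G - {x}" using adj_not_same by (auto simp: adj_in_verts)
      have "nbrs_in adj x (mset_set (verts G)) = card {w \<in> verts G. adj x w}"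
        unfolding nbrs_in_def by (simp add: sum_unfold_sum_mset[symmetric] Int_def)
      also have "{w \<in> verts G. adj x w} = (verts G - {x}) - ?N" by (auto simp: adj_def)
      also have "card \<dots> = ?n - 1 - card ?N"
        using N that by (subst card_Diff_subset) (auto intro: finite_subset)
      finally have "nbrs_in adj x (mset_set (verts G)) = ?n - 1 - card ?N" .
      moreover have "card ?N \<le> ?k"
        unfolding max_degree_def out_degree_eq_card_neighbours[symmetric] using that by (intro Max_ge) auto
      \<comment> \<open>Here |G| - 1 - k = \<alpha> + 2\<beta> + 2.\<close>
      ultimately show ?thesis using n k by linarith
    qed
    show "\<exists>x\<in>I. \<exists>y\<in>I. x \<noteq> y \<and> adj x y" if "I \<subseteq> verts G" "card I = \<alpha> + \<beta> + 3" for I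
    proof (rule ccontr)
      assume "\<not> ?thesis"
      \<comment> \<open>An independent set of the complement is a clique of \<open>G\<close>; on k +
        1 vertices it is an excluded component.\<close>
      then have "u \<rightarrow>\<^bsub>G\<^esub> v" if "u \<in> I" "v \<in> I" "u \<noteq> v" for u v using that unfolding adj_def by blast
      moreover have "card I = ?k + 1" using that k by simp
      ultimately show False using clique_component[OF assms(1) that(1)] assms(5) by blast
    qed
  qed
  have count: "count (mset_set (verts G)) v \<le> 1" for v by (cases "v \<in> verts G"; simp)
  have V: "set_mset (mset_set (verts G)) = verts G" by simp
  have "\<exists>\<pi>. \<pi> ` verts G \<subseteq> {1..?k} \<and>
    (\<forall>u\<in>verts G. \<forall>v\<in>verts G. u \<noteq> v \<longrightarrow> \<pi> u = \<pi> v \<longrightarrow> adj u v) \<and>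
    (\<forall>i\<in>{1..?k}. card {v \<in> verts G. \<pi> v = i} \<in> {2, 3})"
  proof (rule tiling_colouring[OF tiling sym count, unfolded V, folded k])
    fix \<pi> assume "\<pi> ` verts G \<subseteq> {1..?k}"
      "\<And>u v. u \<in> verts G \<Longrightarrow> v \<in> verts G \<Longrightarrow> u \<noteq> v \<Longrightarrow> \<pi> u = \<pi> v \<Longrightarrow> adj u v"
      "\<And>i. i \<in> {1..?k} \<Longrightarrow> card {v \<in> verts G. \<pi> v = i} \<in> {2, 3}"
    then show ?thesis by (intro exI[of _ \<pi>]) blast
  qed
  then obtain \<pi> where \<pi>: "\<pi> ` verts G \<subseteq> {1..?k}"
    "\<And>u v. u \<in> verts G \<Longrightarrow> v \<in> verts G \<Longrightarrow> u \<noteq> v \<Longrightarrow> \<pi> u = \<pi> v \<Longrightarrow> adj u v"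
    "\<And>i. i \<in> {1..?k} \<Longrightarrow> card {v \<in> verts G. \<pi> v = i} \<in> {2, 3}" by blast
  have "is_coloring G ?k \<pi>"
    unfolding is_coloring_def
  proof (intro conjI allI impI)
    show "\<pi> \<in> verts G \<rightarrow> {1..?k}" using \<pi>(1) by auto
    show "\<pi> u \<noteq> \<pi> v" if "u \<rightarrow>\<^bsub>G\<^esub> v" for u v
    proof
      assume "\<pi> u = \<pi> v"
      moreover have "u \<noteq> v" using that adj_not_same by auto
      ultimately have "adj u v" using \<pi>(2) that adj_in_verts by blast
      then show False using that by (simp add: adj_def)
    qed
  qed
  moreover have "\<bar>int (card (color_class G \<pi> i)) - int (card (color_class G \<pi> j))\<bar> \<le> 1"
    if "i \<in> {1..?k}" "j \<in> {1..?k}" for i j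
    using \<pi>(3)[OF that(1)] \<pi>(3)[OF that(2)] by (auto simp: color_class_def)
  ultimately show ?thesis unfolding equitably_colorable_def by blast
qed

end
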